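(* Let $H$ be a complex Hilbert space with $\dim H>1$. Let $\phi: B(H)^+\to B(H)^+$ be a bijective map with the property that \[ A\leq B \Longleftrightarrow \phi(A)\leq \phi(B) \] holds whenever $A,B\in B(H)^+$. Then there exists an invertible bounded either linear or conjugate-linear operator $T:H \to H$ such that \[ \phi(A)=TAT^* \qquad \text{for all } A\in B(H)^+. \]
   Context: $H$ is a complex Hilbert space (of arbitrary, possibly infinite, dimension). $B_s(H)$ denotes the set of all self-adjoint bounded linear operators on $H$, and $B(H)^+$ denotes the cone of all positive operators on $H$, i.e. the set of all $A\in B_s(H)$ with $\langle Ax,x\rangle\geq 0$ for every $x\in H$. For $A,B\in B_s(H)$, $A\leq B$ means $\langle Ax,x\rangle\leq\langle Bx,x\rangle$ for every $x\in H$. No linearity or continuity of $\phi$ is assumed. For a bounded linear $T$, $T^*$ is the usual adjoint; for a bounded conjugate-linear $T$, $T^*$ is the bounded conjugate-linear operator determined by $\langle Tx,y\rangle=\langle T^*y,x\rangle$ for all $x,y\in H$ (so $TAT^*$ is a linear operator in both cases). *)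

theory Defs
  imports "HOL-Analysis.Analysis" "HOL-Library.Complex_Order"
begin

text \<open>
  A complex inner product space, presented over its underlying real inner product space, so that
  the norm, topology and completeness of HOL-Analysis apply: the real inner product is the real
  part of the complex one, hence the norm of \<open>x\<close> is the square root of \<open>cinner x x\<close>, and
  positive definiteness of \<open>cinner\<close> is inherited from \<open>inner\<close>. The product \<open>cinner\<close> is linear in
  its first argument.
\<close>

class complex_inner = real_inner +
  fixes scaleC :: "complex \<Rightarrow> 'a \<Rightarrow> 'a" (infixr "*\<^sub>C" 75)
    and cinner :: "'a \<Rightarrow> 'a \<Rightarrow> complex"
  assumes scaleC_add_right: "a *\<^sub>C (x + y) = a *\<^sub>C x + a *\<^sub>C y"
    and scaleC_add_left: "(a + b) *\<^sub>C x = a *\<^sub>C x + b *\<^sub>C x"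
    and scaleC_scaleC: "a *\<^sub>C b *\<^sub>C x = (a * b) *\<^sub>C x"
    and scaleC_one: "1 *\<^sub>C x = x"
    and scaleR_scaleC: "r *\<^sub>R x = complex_of_real r *\<^sub>C x"
    and cinner_commute: "cinner x y = cnj (cinner y x)"
    and cinner_add_left: "cinner (x + y) z = cinner x z + cinner y z"
    and cinner_scaleC_left: "cinner (a *\<^sub>C x) y = a * cinner x y"
    and inner_eq_Re_cinner: "inner x y = Re (cinner x y)"

class chilbert_space = complex_inner + complete_space

global_interpretation complex_vector:
  vector_space "scaleC :: complex \<Rightarrow> 'a \<Rightarrow> 'a::complex_inner"
  by unfold_locales (simp_all add: scaleC_add_right scaleC_add_left scaleC_scaleC scaleC_one)

text \<open>
  \<open>bounded_linear\<close> is real linearity together with boundedness; it supplies additivity, and the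
  second conjunct supplies (conjugate) homogeneity over the complex numbers.
\<close>

definition bounded_clinear :: "('a::complex_inner \<Rightarrow> 'b::complex_inner) \<Rightarrow> bool" where
  "bounded_clinear T \<longleftrightarrow> bounded_linear T \<and> (\<forall>c x. T (c *\<^sub>C x) = c *\<^sub>C T x)"

definition bounded_antilinear :: "('a::complex_inner \<Rightarrow> 'b::complex_inner) \<Rightarrow> bool" where
  "bounded_antilinear T \<longleftrightarrow> bounded_linear T \<and> (\<forall>c x. T (c *\<^sub>C x) = cnj c *\<^sub>C T x)"

definition invertible_op :: "('a::complex_inner \<Rightarrow> 'a) \<Rightarrow> bool" where
  "invertible_op T \<longleftrightarrow> bij T \<and> bounded_linear (inv T)"

text \<open>
  The adjoints of a bounded linear and of a bounded conjugate-linear operator. On a Hilbert space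
  both descriptions have exactly one solution by the Riesz representation theorem.
\<close>

definition cadjoint :: "('a::chilbert_space \<Rightarrow> 'a) \<Rightarrow> 'a \<Rightarrow> 'a" where
  "cadjoint T = (THE S. bounded_clinear S \<and> (\<forall>x y. cinner (T x) y = cinner x (S y)))"

definition antiadjoint :: "('a::chilbert_space \<Rightarrow> 'a) \<Rightarrow> 'a \<Rightarrow> 'a" where
  "antiadjoint T = (THE S. bounded_antilinear S \<and> (\<forall>x y. cinner (T x) y = cinner (S y) x))"

definition selfadjoint_ops :: "('a::chilbert_space \<Rightarrow> 'a) set" where
  "selfadjoint_ops = {A. bounded_clinear A \<and> cadjoint A = A}"

text \<open>
  The orders below are those of the complex numbers from HOL-Library: \<open>z \<le> w\<close> means that
  \<open>Re z \<le> Re w\<close> and \<open>Im z = Im w\<close>. For self-adjoint operators the values compared are real.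
\<close>

definition positive_ops :: "('a::chilbert_space \<Rightarrow> 'a) set" where
  "positive_ops = {A \<in> selfadjoint_ops. \<forall>x. 0 \<le> cinner (A x) x}"

definition op_le :: "('a::chilbert_space \<Rightarrow> 'a) \<Rightarrow> ('a \<Rightarrow> 'a) \<Rightarrow> bool" (infix "\<preceq>" 50) where
  "A \<preceq> B \<longleftrightarrow> (\<forall>x. cinner (A x) x \<le> cinner (B x) x)"

end

theory Submission
  imports Defs "HOL-Library.Function_Algebras"
begin

text \<open>
  Write \<open>rank1 t x\<close> for the operator \<open>v \<mapsto> t \<langle>v, x\<rangle> x\<close>. The order on positive operators sees
  these operators, and they see the order. On the one hand, \<open>B - A\<close> has rank at most one exactly
  when the interval between \<open>A\<close> and \<open>B\<close> is a chain (\<open>chain_interval_rank1\<close>,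
  \<open>rank1_if_chain_interval\<close>); so \<open>\<phi>\<close> maps each half-line \<open>A + t \<cdot> rank1 x\<close> into a half-line of the
  same kind that starts at \<open>\<phi> A\<close>. On the other hand, by the Cauchy-Schwarz inequality a positive
  operator is the supremum of the rank-one operators below it (\<open>op_le_if_rank1_le\<close>), so that
  \<open>\<phi>\<close> is determined by its values on rank-one operators.

  The direction of an image half-line depends on \<open>x\<close> only, not on its origin \<open>A\<close>
  (\<open>plus_rank1\<close>). This is what makes \<open>\<phi>\<close> additive: going from \<open>A\<close> along \<open>x\<close> and then along a
  non-parallel \<open>y\<close>, or in the other order, produces two decompositions of one operator along the
  same two independent directions, whence the length of the image of a step along \<open>x\<close> is unaffected
  by steps along \<open>y\<close>. It is unaffected by steps along \<open>x\<close> as well, since in dimension at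
  least two the parallelogram law trades a step along \<open>x\<close> (and one along \<open>y\<close>) for steps along
  \<open>x + y\<close> and \<open>x - y\<close> (\<open>increment_shift\<close>). So the length is an additive, nonnegative function of
  the step, hence linear, and \<open>\<phi>\<close> is additive and homogeneous on positive operators of finite rank
  (\<open>image_rank1\<close>, \<open>image_sum_list\<close>).

  Now \<open>x \<mapsto> \<phi> (rank1 1 x)\<close> is a quadratic map with rank-one values. Polarising it against a
  fixed vector \<open>e\<close> yields an operator, complex linear in \<open>x\<close>, which for each \<open>x\<close> is either
  \<open>v \<mapsto> \<langle>v, E\<rangle> a\<close> or \<open>v \<mapsto> \<langle>v, a\<rangle> E\<close> where \<open>\<phi> (rank1 1 e) = rank1 1 E\<close> and
  \<open>\<phi> (rank1 1 x) = rank1 1 a\<close> (\<open>cross_dichotomy\<close>). A vector space is not the union of two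
  proper subgroups, so that one alternative holds throughout; \<open>x \<mapsto> a\<close> is the operator \<open>T\<close>, linear
  in the first case and conjugate-linear in the second (\<open>implementing_map\<close>).

  Boundedness of \<open>T\<close> and the adjoint are read off from \<open>\<phi> id\<close>, which has to be
  \<open>T \<circ> T\<^sup>*\<close>: the operator \<open>inv T \<circ> \<phi> id\<close> is an adjoint of \<open>T\<close> (\<open>inner_adj\<close>). Comparing
  rank-one operators then gives \<open>\<phi> A \<preceq> T \<circ> A \<circ> T\<^sup>*\<close>, and the same inequality for the inverse of
  \<open>\<phi>\<close> is the reverse one.
\<close>

section \<open>Complex inner products\<close>

lemma cinner_add_right: "cinner x (y + z) = cinner x y + cinner x z"
  by (metis cinner_add_left cinner_commute complex_cnj_add)

lemma cinner_scaleC_right: "cinner x (a *\<^sub>C y) = cnj a * cinner x y"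
  by (metis cinner_scaleC_left cinner_commute complex_cnj_mult)

lemma cinner_zero_left [simp]: "cinner 0 x = 0"
  using cinner_add_left [of 0 0 x] by simp

lemma cinner_zero_right [simp]: "cinner x 0 = 0"
  using cinner_add_right [of x 0 0] by simp

lemma cinner_minus_left [simp]: "cinner (- x) y = - cinner x y"
  using cinner_add_left [of x "- x" y] by (simp add: eq_neg_iff_add_eq_0 add.commute)

lemma cinner_minus_right [simp]: "cinner x (- y) = - cinner x y"
  using cinner_add_right [of x y "- y"] by (simp add: eq_neg_iff_add_eq_0 add.commute)

lemma cinner_diff_left: "cinner (x - y) z = cinner x z - cinner y z"
  using cinner_add_left [of x "- y" z] by simp

lemma cinner_diff_right: "cinner x (y - z) = cinner x y - cinner x z"
  using cinner_add_right [of x y "- z"] by simp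

lemma cinner_scaleR_left [simp]: "cinner (r *\<^sub>R x) y = of_real r * cinner x y"
  by (simp add: scaleR_scaleC cinner_scaleC_left)

lemmas cinner_simps = cinner_add_left cinner_add_right cinner_diff_left cinner_diff_right
  cinner_scaleC_left cinner_scaleC_right

lemma cinner_self: "cinner x x = of_real ((norm x)\<^sup>2)"
proof -
  have "Im (cinner x x) = 0"
    using cinner_commute [of x x] by (simp add: complex_eq_iff)
  moreover have "Re (cinner x x) = (norm x)\<^sup>2"
    using inner_eq_Re_cinner [of x x] by (simp add: power2_norm_eq_inner)
  ultimately show ?thesis by (simp add: complex_eq_iff)
qed

lemma cinner_self_eq_0 [simp]: "cinner x x = 0 \<longleftrightarrow> x = 0"
  by (simp add: cinner_self)

lemma cinner_eqI: "(\<And>v. cinner v x = cinner v y) \<Longrightarrow> x = y"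
  by (metis cinner_diff_right cinner_self_eq_0 eq_iff_diff_eq_0)

lemma cinner_eq_Complex_inner: "cinner x y = Complex (inner x y) (inner x (\<i> *\<^sub>C y))"
  by (simp add: complex_eq_iff inner_eq_Re_cinner cinner_scaleC_right)

lemma mult_cnj_self: "z * cnj z = complex_of_real ((cmod z)\<^sup>2)"
  by (simp only: complex_norm_square)

lemma norm_scaleC: "norm (c *\<^sub>C x) = cmod c * norm x"
proof -
  have "complex_of_real ((norm (c *\<^sub>C x))\<^sup>2) = (c * cnj c) * of_real ((norm x)\<^sup>2)"
    unfolding cinner_self [symmetric] by (simp add: cinner_scaleC_left cinner_scaleC_right)
  also have "\<dots> = of_real ((cmod c * norm x)\<^sup>2)"
    unfolding mult_cnj_self by (simp add: power_mult_distrib)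
  finally have "(norm (c *\<^sub>C x))\<^sup>2 = (cmod c * norm x)\<^sup>2"
    by (simp only: of_real_eq_iff)
  then show ?thesis by simp
qed

text \<open>
  Rank-one inequalities only give information on orthogonal complements; this turns it into
  parallelism of vectors.
\<close>

lemma in_span_if_orthogonal:
  assumes "\<And>v. cinner v z = 0 \<Longrightarrow> cinner v x = 0"
  shows "\<exists>c. x = c *\<^sub>C z"
proof -
  define c where "c = cinner x z / cinner z z"
  define v where "v = x - c *\<^sub>C z"
  have vz: "cinner v z = 0"
    by (cases "z = 0") (simp_all add: v_def c_def cinner_simps)
  then have "cinner v v = 0"
    using assms [of v] by (simp add: v_def cinner_diff_right cinner_scaleC_right)
  then show ?thesis
    by (metis cinner_self_eq_0 eq_iff_diff_eq_0 v_def)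
qed

lemma orthogonal_witness:
  assumes "\<nexists>c. x = c *\<^sub>C z"
  obtains v where "cinner v z = 0" "cinner v x \<noteq> 0"
  using assms in_span_if_orthogonal by blast

lemma parallel_sym:
  assumes "x = c *\<^sub>C z" "x \<noteq> 0"
  shows "\<exists>d. z = d *\<^sub>C x"
proof
  have "c \<noteq> 0" using assms by auto
  then show "z = (1 / c) *\<^sub>C x" by (simp add: assms scaleC_scaleC scaleC_one)
qed

lemma not_parallel_nonzero: "\<nexists>c. x = c *\<^sub>C z \<Longrightarrow> x \<noteq> 0"
  by (metis complex_vector.scale_zero_left)

section \<open>Positive operators\<close>

lemma bounded_clinear_scaleC: "bounded_clinear A \<Longrightarrow> A (c *\<^sub>C x) = c *\<^sub>C A x"
  by (simp add: bounded_clinear_def)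

lemma bounded_clinear_add: "bounded_clinear A \<Longrightarrow> A (x + y) = A x + A y"
  by (simp add: bounded_clinear_def bounded_linear.linear linear_add)

lemma bounded_clinear_diff: "bounded_clinear A \<Longrightarrow> A (x - y) = A x - A y"
  by (simp add: bounded_clinear_def bounded_linear.linear linear_diff)

lemma bounded_clinear_zero: "bounded_clinear A \<Longrightarrow> A 0 = 0"
  by (simp add: bounded_clinear_def bounded_linear.linear linear_0)

lemmas bounded_clinear_simps =
  bounded_clinear_add bounded_clinear_diff bounded_clinear_scaleC bounded_clinear_zero

lemma cadjoint_eqI:
  assumes "bounded_clinear S" "\<And>x y. cinner (T x) y = cinner x (S y)"
  shows "cadjoint T = S"
  unfolding cadjoint_def
proof (rule the_equality)
  fix S' assume "bounded_clinear S' \<and> (\<forall>x y. cinner (T x) y = cinner x (S' y))"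
  then show "S' = S" using assms by (intro ext cinner_eqI) metis
qed (use assms in blast)

lemma antiadjoint_eqI:
  assumes "bounded_antilinear S" "\<And>x y. cinner (T x) y = cinner (S y) x"
  shows "antiadjoint T = S"
  unfolding antiadjoint_def
proof (rule the_equality)
  fix S' assume "bounded_antilinear S' \<and> (\<forall>x y. cinner (T x) y = cinner (S' y) x)"
  then show "S' = S"
    using assms by (intro ext cinner_eqI) (metis cinner_commute)
qed (use assms in blast)

text \<open>
  Polarisation over the complex numbers: a form with a real diagonal is Hermitian. Positivity
  therefore entails symmetry, and membership in \<open>positive_ops\<close> can be checked without
  any adjoint.
\<close>

lemma symmetric_if_real_form:
  assumes A: "bounded_clinear A" and real: "\<And>x. Im (cinner (A x) x) = 0"
  shows "cinner (A x) y = cinner x (A y)"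
proof -
  have *: "Im (cinner (A u) v + cinner (A v) u) = 0" for u v
    using real [of "u + v"] real [of u] real [of v]
    by (simp add: bounded_clinear_add [OF A] cinner_simps)
  have "Im (cinner (A x) y + cinner (A y) x) = 0"
    and "Im (cinner (A x) (\<i> *\<^sub>C y) + cinner (A (\<i> *\<^sub>C y)) x) = 0"
    using * by blast+
  then have "cinner (A x) y = cnj (cinner (A y) x)"
    by (simp add: complex_eq_iff cinner_simps bounded_clinear_scaleC [OF A])
  then show ?thesis using cinner_commute by metis
qed

lemma positive_ops_iff:
  "A \<in> positive_ops \<longleftrightarrow> bounded_clinear A \<and> (\<forall>x. 0 \<le> cinner (A x) x)"
proof
  assume A: "bounded_clinear A \<and> (\<forall>x. 0 \<le> cinner (A x) x)"
  then have "cinner (A x) y = cinner x (A y)" for x y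
    by (intro symmetric_if_real_form) (auto simp: less_eq_complex_def)
  with A show "A \<in> positive_ops"
    by (auto simp: positive_ops_def selfadjoint_ops_def intro!: cadjoint_eqI)
qed (auto simp: positive_ops_def selfadjoint_ops_def)

lemma positive_ops_clinear: "A \<in> positive_ops \<Longrightarrow> bounded_clinear A"
  and positive_ops_form_nonneg: "A \<in> positive_ops \<Longrightarrow> 0 \<le> inner (A x) x"
  and positive_ops_form: "A \<in> positive_ops \<Longrightarrow> cinner (A x) x = of_real (inner (A x) x)"
  by (auto simp: positive_ops_iff less_eq_complex_def inner_eq_Re_cinner complex_eq_iff)

lemma positive_ops_symmetric: "A \<in> positive_ops \<Longrightarrow> cinner (A x) y = cinner x (A y)"
  by (rule symmetric_if_real_form) (auto simp: positive_ops_iff less_eq_complex_def)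

lemma op_le_iff:
  assumes "A \<in> positive_ops" "B \<in> positive_ops"
  shows "A \<preceq> B \<longleftrightarrow> (\<forall>x. inner (A x) x \<le> inner (B x) x)"
  by (simp add: op_le_def positive_ops_form [OF assms(1)] positive_ops_form [OF assms(2)]
      less_eq_complex_def)

lemma op_leD: "A \<preceq> B \<Longrightarrow> inner (A x) x \<le> inner (B x) x"
  by (simp add: op_le_def less_eq_complex_def inner_eq_Re_cinner)

lemma op_le_refl: "A \<preceq> A"
  by (simp add: op_le_def)

lemma bounded_clinear_plus: "bounded_clinear A \<Longrightarrow> bounded_clinear B \<Longrightarrow> bounded_clinear (A + B)"
  unfolding bounded_clinear_def plus_fun_def
  by (auto intro: bounded_linear_add simp: scaleC_add_right)

lemma bounded_clinear_minus: "bounded_clinear A \<Longrightarrow> bounded_clinear B \<Longrightarrow> bounded_clinear (A - B)"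
  unfolding bounded_clinear_def fun_diff_def
  by (auto intro: bounded_linear_sub simp: complex_vector.scale_right_diff_distrib)

lemma plus_positive_ops: "A \<in> positive_ops \<Longrightarrow> B \<in> positive_ops \<Longrightarrow> A + B \<in> positive_ops"
  by (simp add: positive_ops_iff bounded_clinear_plus cinner_add_left)

lemma zero_positive_ops: "0 \<in> positive_ops"
  by (simp add: positive_ops_iff bounded_clinear_def zero_fun_def)

lemma id_positive_ops: "id \<in> positive_ops"
  by (simp add: positive_ops_iff bounded_clinear_def id_def cinner_self less_eq_complex_def
      del: of_real_power)

lemma minus_positive_ops:
  assumes "A \<in> positive_ops" "B \<in> positive_ops" "A \<preceq> B"
  shows "B - A \<in> positive_ops"
  using assms by (simp add: positive_ops_iff bounded_clinear_minus op_le_def cinner_diff_left)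

lemma op_le_plus: "B \<in> positive_ops \<Longrightarrow> A \<preceq> A + B"
  by (simp add: positive_ops_iff op_le_def cinner_add_left)

lemma op_le_cancel: "A + B \<preceq> A + C \<longleftrightarrow> B \<preceq> C"
  by (simp add: op_le_def cinner_add_left)

text \<open>
  The difference of the two operators has a form that vanishes on the diagonal, hence everywhere
  by polarisation.
\<close>

lemma op_le_antisym:
  assumes A: "A \<in> positive_ops" and B: "B \<in> positive_ops" and "A \<preceq> B" "B \<preceq> A"
  shows "A = B"
proof -
  define D where "D = B - A"
  have D: "D \<in> positive_ops"
    unfolding D_def using assms by (intro minus_positive_ops)
  have form: "cinner (D x) x = 0" for x
    using assms by (simp add: D_def op_le_def cinner_diff_left eq_iff)
  have re: "Re (cinner (D x) y) = 0" for x y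
  proof -
    have "cinner (D (x + y)) (x + y) = 0" by (rule form)
    then have "cinner (D x) y + cinner (D y) x = 0"
      by (simp add: cinner_simps bounded_clinear_simps positive_ops_clinear [OF D] form
          add.commute)
    moreover have "cinner (D y) x = cnj (cinner (D x) y)"
      using positive_ops_symmetric [OF D, of y x] cinner_commute by metis
    ultimately show ?thesis by (simp add: complex_eq_iff)
  qed
  have "D x = 0" for x
    using re [of x "D x"] by (simp add: cinner_self)
  then show ?thesis by (simp add: D_def fun_eq_iff)
qed

text \<open>
  The Cauchy-Schwarz inequality for the form of a positive operator \<open>A\<close>, in its two guises: where
  the form vanishes the operator vanishes, and elsewhere \<open>A x\<close> spans a rank-one operator
  below \<open>A\<close>.
\<close>

lemma positive_ops_kernel:
  assumes A: "A \<in> positive_ops" and 0: "inner (A x) x = 0"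
  shows "A x = 0"
proof -
  define a where "a = inner (A (A x)) (A x)"
  have lin: "bounded_clinear A" by (rule positive_ops_clinear [OF A])
  have "0 \<le> a + 2 * t * (norm (A x))\<^sup>2" for t
  proof -
    have "cinner (A (A x + t *\<^sub>R x)) (A x + t *\<^sub>R x) = of_real (a + 2 * t * (norm (A x))\<^sup>2)"
      using positive_ops_symmetric [OF A, of "A x" x] positive_ops_form [OF A, of x]
        positive_ops_form [OF A, of "A x"]
      by (simp add: scaleR_scaleC cinner_simps bounded_clinear_simps [OF lin] a_def cinner_self 0)
    then show ?thesis
      using positive_ops_form_nonneg [OF A, of "A x + t *\<^sub>R x"]
      by (simp add: inner_eq_Re_cinner)
  qed
  \<comment> \<open>This step makes the affine function of \<open>t\<close> negative, unless its slope is \<open>0\<close>.\<close>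
  from this [of "- (a + 1) / (2 * (norm (A x))\<^sup>2)"] show ?thesis
    by (cases "A x = 0") (simp_all add: field_simps)
qed

lemma positive_ops_Cauchy_Schwarz:
  assumes A: "A \<in> positive_ops" and pos: "0 < inner (A x) x"
  shows "(cmod (cinner v (A x)))\<^sup>2 / inner (A x) x \<le> inner (A v) v"
proof -
  define a where "a = inner (A x) x"
  define z where "z = cinner v (A x)"
  have lin: "bounded_clinear A" by (rule positive_ops_clinear [OF A])
  \<comment> \<open>The component of \<open>v\<close> orthogonal to \<open>x\<close> for the form of \<open>A\<close>.\<close>
  define u where "u = v - (z / a) *\<^sub>C x"
  have a: "a \<noteq> 0" using pos by (simp add: a_def)
  have Avx: "cinner (A v) x = z" using positive_ops_symmetric [OF A] z_def by metis
  have Axv: "cinner (A x) v = cnj z" unfolding z_def using cinner_commute by metis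
  have "cinner (A u) u = of_real (inner (A v) v) - z * cnj z / a"
    using a positive_ops_form [OF A, of x] positive_ops_form [OF A, of v]
    by (simp add: u_def cinner_simps bounded_clinear_simps [OF lin] Avx Axv a_def [symmetric]
        field_simps power2_eq_square)
  then have "cinner (A u) u = of_real (inner (A v) v - (cmod z)\<^sup>2 / a)"
    unfolding mult_cnj_self by simp
  then show ?thesis
    using positive_ops_form_nonneg [OF A, of u] by (simp add: inner_eq_Re_cinner a_def z_def)
qed

section \<open>Rank-one operators\<close>

definition rank1 :: "real \<Rightarrow> 'a::complex_inner \<Rightarrow> 'a \<Rightarrow> 'a" where
  "rank1 t x v = t *\<^sub>R (cinner v x *\<^sub>C x)"

lemma rank1_form: "cinner (rank1 t x v) v = of_real (t * (cmod (cinner v x))\<^sup>2)"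
proof -
  have "cinner (rank1 t x v) v = of_real t * (cinner v x * cnj (cinner v x))"
    unfolding rank1_def by (metis cinner_commute cinner_scaleC_left cinner_scaleR_left)
  then show ?thesis unfolding mult_cnj_self by simp
qed

lemma rank1_inner: "inner (rank1 t x v) v = t * (cmod (cinner v x))\<^sup>2"
  unfolding inner_eq_Re_cinner rank1_form by simp

lemma bounded_clinear_rank1: "bounded_clinear (rank1 t x)"
  unfolding bounded_clinear_def
proof (intro conjI allI)
  show "rank1 t x (c *\<^sub>C v) = c *\<^sub>C rank1 t x v" for c v
    by (simp add: rank1_def cinner_simps scaleR_scaleC scaleC_scaleC mult_ac)
  show "bounded_linear (rank1 t x)"
  proof (rule bounded_linear_intro)
    show "rank1 t x (v + u) = rank1 t x v + rank1 t x u" for u v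
      by (simp add: rank1_def cinner_simps scaleC_add_left scaleR_add_right)
    show "rank1 t x (r *\<^sub>R v) = r *\<^sub>R rank1 t x v" for r v
      by (simp add: rank1_def scaleR_scaleC cinner_simps scaleC_scaleC mult_ac)
    have cs: "cmod (cinner v x) \<le> 2 * (norm v * norm x)" for v
    proof -
      have "cmod (cinner v x) \<le> \<bar>inner v x\<bar> + \<bar>inner v (\<i> *\<^sub>C x)\<bar>"
        by (subst cinner_eq_Complex_inner) (metis cmod_le complex.sel)
      also have "\<dots> \<le> norm v * norm x + norm v * norm x"
        using Cauchy_Schwarz_ineq2 [of v x] Cauchy_Schwarz_ineq2 [of v "\<i> *\<^sub>C x"]
        by (simp add: norm_scaleC)
      finally show ?thesis by simp
    qed
    show "norm (rank1 t x v) \<le> norm v * (2 * \<bar>t\<bar> * norm x * norm x)" for v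
      using mult_right_mono [OF cs [of v], of "\<bar>t\<bar> * norm x"]
      by (simp add: rank1_def norm_scaleC algebra_simps)
  qed
qed

lemma rank1_positive_ops: "0 \<le> t \<Longrightarrow> rank1 t x \<in> positive_ops"
  by (simp add: positive_ops_iff bounded_clinear_rank1 rank1_form less_eq_complex_def
      del: of_real_power of_real_mult)

lemma rank1_zero [simp]: "rank1 t 0 = 0" "rank1 0 x = 0"
  by (simp_all add: rank1_def fun_eq_iff)

lemma rank1_add: "rank1 (s + t) x = rank1 s x + rank1 t x"
  by (simp add: rank1_def fun_eq_iff scaleR_add_left)

lemma rank1_scaleC: "rank1 t (c *\<^sub>C x) = rank1 (t * (cmod c)\<^sup>2) x"
proof
  fix v
  have "rank1 t (c *\<^sub>C x) v = (of_real t * cinner v x * (c * cnj c)) *\<^sub>C x"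
    by (simp add: rank1_def scaleR_scaleC cinner_scaleC_right scaleC_scaleC mult_ac)
  then show "rank1 t (c *\<^sub>C x) v = rank1 (t * (cmod c)\<^sup>2) x v"
    unfolding mult_cnj_self by (simp add: rank1_def scaleR_scaleC scaleC_scaleC mult_ac)
qed

lemma rank1_scaleR: "rank1 t (c *\<^sub>R x) = rank1 (t * c\<^sup>2) x"
  by (simp add: scaleR_scaleC rank1_scaleC)

lemma rank1_eq_unit: "0 \<le> t \<Longrightarrow> rank1 t x = rank1 1 (sqrt t *\<^sub>R x)"
  by (simp add: rank1_scaleR)

lemma rank1_parallelogram:
  "rank1 t (x + y) + rank1 t (x - y) = rank1 (2 * t) x + rank1 (2 * t) y"
proof
  fix v
  have "cinner v (x + y) *\<^sub>C (x + y) + cinner v (x - y) *\<^sub>C (x - y)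
      = (cinner v x *\<^sub>C x + cinner v x *\<^sub>C x) + (cinner v y *\<^sub>C y + cinner v y *\<^sub>C y)"
    by (simp add: cinner_simps scaleC_add_right scaleC_add_left
        complex_vector.scale_right_diff_distrib complex_vector.scale_left_diff_distrib)
  then show "(rank1 t (x + y) + rank1 t (x - y)) v = (rank1 (2 * t) x + rank1 (2 * t) y) v"
    by (simp add: rank1_def scaleR_add_right [symmetric] scaleR_2 [symmetric] mult.commute)
qed

lemma rank1_le_mono: "s \<le> t \<Longrightarrow> rank1 s x \<preceq> rank1 t x"
  by (simp add: op_le_def rank1_form mult_right_mono less_eq_complex_def)

lemma rank1_inj:
  assumes "rank1 s x = rank1 t x" "x \<noteq> 0"
  shows "s = t"
  using fun_cong [OF assms(1), of x] assms(2) by (simp add: rank1_def cinner_self)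

lemma rank1_eq_0_iff [simp]: "rank1 t x = 0 \<longleftrightarrow> t = 0 \<or> x = 0"
proof
  assume "rank1 t x = 0"
  then have "rank1 t x = rank1 0 x" by simp
  then show "t = 0 \<or> x = 0" using rank1_inj by blast
qed auto

lemma rank1_le_imp_parallel:
  assumes "rank1 s x \<preceq> rank1 t z" "0 < s"
  shows "\<exists>c. x = c *\<^sub>C z"
proof (rule in_span_if_orthogonal)
  fix v assume "cinner v z = 0"
  then have "s * (cmod (cinner v x))\<^sup>2 \<le> 0"
    using op_leD [OF assms(1), of v] by (simp add: rank1_inner)
  then show "cinner v x = 0" using assms(2) by (simp add: mult_le_0_iff)
qed

lemma rank1_below_positive_op:
  assumes "A \<in> positive_ops" "0 < inner (A x) x"
  shows "rank1 (1 / inner (A x) x) (A x) \<preceq> A"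
  using positive_ops_Cauchy_Schwarz [OF assms] assms
  by (subst op_le_iff) (auto simp: rank1_inner intro: rank1_positive_ops)

text \<open>
  A positive operator is the supremum of the rank-one operators below it, so that the order on
  positive operators is decided by rank-one operators: already the operator spanned by
  \<open>A x\<close> attains the value of the form of \<open>A\<close> at \<open>x\<close>.
\<close>

lemma op_le_if_rank1_le:
  assumes A: "A \<in> positive_ops" and B: "B \<in> positive_ops"
    and le: "\<And>z. rank1 1 z \<preceq> A \<Longrightarrow> rank1 1 z \<preceq> B"
  shows "A \<preceq> B"
  unfolding op_le_iff [OF A B]
proof
  fix x
  define a where "a = inner (A x) x"
  show "inner (A x) x \<le> inner (B x) x"
  proof (cases "a = 0")
    case True
    then show ?thesis using positive_ops_form_nonneg [OF B, of x] by (simp add: a_def)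
  next
    case False
    then have a: "0 < a" using positive_ops_form_nonneg [OF A, of x] by (simp add: a_def)
    then have "rank1 (1 / a) (A x) \<preceq> B"
      using rank1_below_positive_op [OF A, of x] le [of "sqrt (1 / a) *\<^sub>R A x"]
      by (simp add: a_def rank1_scaleR)
    from op_leD [OF this, of x] have "1 / a * (cmod (cinner x (A x)))\<^sup>2 \<le> inner (B x) x"
      by (simp add: rank1_inner)
    moreover have "cmod (cinner x (A x)) = a"
      unfolding positive_ops_symmetric [OF A, of x x, symmetric] positive_ops_form [OF A, of x]
      using a by (simp add: a_def)
    ultimately show ?thesis using a by (simp add: a_def power2_eq_square)
  qed
qed

text \<open>
  The range of a symmetric operator is orthogonal to its kernel, so that \<open>D r\<close> is a multiple of \<open>r\<close>.
\<close>

lemma rank1_if_kernel: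
  assumes D: "D \<in> positive_ops" and ker: "\<And>v. cinner v r = 0 \<Longrightarrow> D v = 0"
  shows "\<exists>s\<ge>0. D = rank1 s r"
proof (cases "r = 0")
  case True
  then have "D = rank1 0 r" using ker by (simp add: fun_eq_iff)
  then show ?thesis by blast
next
  case False
  have lin: "bounded_clinear D" by (rule positive_ops_clinear [OF D])
  have "\<exists>k. D r = k *\<^sub>C r"
  proof (rule in_span_if_orthogonal)
    fix v assume "cinner v r = 0"
    then show "cinner v (D r) = 0"
      using positive_ops_symmetric [OF D, of v r] ker by simp
  qed
  then obtain k where k: "D r = k *\<^sub>C r" by blast
  have "0 \<le> cinner (D r) r" using D by (simp add: positive_ops_iff)
  then have "0 \<le> k" using False
    by (simp add: k cinner_scaleC_left cinner_self less_eq_complex_def zero_le_mult_iff)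
  then obtain s where s: "k = of_real s" "0 \<le> s"
    by (metis complex_is_Real_iff less_eq_complex_def of_real_Re zero_complex.simps)
  have "D v = rank1 (s / (norm r)\<^sup>2) r v" for v
  proof -
    define c where "c = cinner v r / cinner r r"
    have "D (v - c *\<^sub>C r) = 0"
      using False by (intro ker) (simp add: c_def cinner_simps)
    then have "D v = c *\<^sub>C D r" by (simp add: bounded_clinear_simps [OF lin])
    then show ?thesis
      by (simp add: k s c_def rank1_def cinner_self scaleR_scaleC scaleC_scaleC mult_ac)
  qed
  then show ?thesis using s(2) by (intro exI [of _ "s / (norm r)\<^sup>2"]) (simp add: fun_eq_iff)
qed

lemma below_rank1:
  assumes D: "D \<in> positive_ops" and le: "D \<preceq> rank1 t r"
  shows "\<exists>s\<ge>0. D = rank1 s r"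
proof (rule rank1_if_kernel [OF D])
  fix v assume "cinner v r = 0"
  then have "inner (D v) v \<le> 0" using op_leD [OF le, of v] by (simp add: rank1_inner)
  then show "D v = 0"
    using positive_ops_form_nonneg [OF D, of v] by (intro positive_ops_kernel [OF D]) simp
qed

definition chain_interval :: "('a::chilbert_space \<Rightarrow> 'a) \<Rightarrow> ('a \<Rightarrow> 'a) \<Rightarrow> bool" where
  "chain_interval A B \<longleftrightarrow> (\<forall>C\<in>positive_ops. \<forall>D\<in>positive_ops.
     A \<preceq> C \<longrightarrow> C \<preceq> B \<longrightarrow> A \<preceq> D \<longrightarrow> D \<preceq> B \<longrightarrow> C \<preceq> D \<or> D \<preceq> C)"

text \<open>
  The order sees the rank-one operators: \<open>B - A\<close> has rank at most one exactly when the interval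
  between \<open>A\<close> and \<open>B\<close> is a chain. For if \<open>D = B - A\<close> has two non-parallel vectors
  \<open>D x\<close>, \<open>D y\<close> in its range, then the rank-one operators below \<open>D\<close> that they span are
  incomparable.
\<close>

lemma chain_interval_rank1:
  assumes A: "A \<in> positive_ops"
  shows "chain_interval A (A + rank1 1 r)"
  unfolding chain_interval_def
proof (intro ballI impI)
  have *: "\<exists>s. C = A + rank1 s r"
    if C: "C \<in> positive_ops" "A \<preceq> C" "C \<preceq> A + rank1 1 r" for C
  proof -
    have "C - A \<preceq> rank1 1 r"
      using C(3) op_le_cancel [of A "C - A" "rank1 1 r"] by simp
    then obtain s where "C - A = rank1 s r"
      using below_rank1 minus_positive_ops [OF A C(1,2)] by blast
    then show ?thesis by (metis add_diff_cancel_left' diff_add_cancel add.commute)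
  qed
  fix C D assume "C \<in> positive_ops" "D \<in> positive_ops" "A \<preceq> C" "C \<preceq> A + rank1 1 r"
    "A \<preceq> D" "D \<preceq> A + rank1 1 r"
  then obtain s t where "C = A + rank1 s r" "D = A + rank1 t r" using * by metis
  then show "C \<preceq> D \<or> D \<preceq> C"
    using rank1_le_mono [of s t r] rank1_le_mono [of t s r] linear [of s t] by (auto simp: op_le_cancel)
qed

lemma rank1_if_chain_interval:
  assumes A: "A \<in> positive_ops" and B: "B \<in> positive_ops" and le: "A \<preceq> B"
    and chain: "chain_interval A B"
  shows "\<exists>r. B = A + rank1 1 r"
proof -
  define D where "D = B - A"
  have D: "D \<in> positive_ops"
    unfolding D_def by (rule minus_positive_ops [OF A B le])
  have B_eq: "B = A + D" by (simp add: D_def)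
  have "\<exists>r. \<exists>s\<ge>0. D = rank1 s r"
  proof (cases "\<exists>x. D x \<noteq> 0")
    case False
    then have "D = rank1 0 0" by (simp add: fun_eq_iff)
    then show ?thesis by blast
  next
    case True
    then obtain x0 where x0: "D x0 \<noteq> 0" by blast
    define P where "P x = rank1 (1 / inner (D x) x) (D x)" for x
    have pos: "0 < inner (D x) x" if "D x \<noteq> 0" for x
      using positive_ops_kernel [OF D] positive_ops_form_nonneg [OF D, of x] that
      by (metis order_le_less)
    have P: "P x \<in> positive_ops" "P x \<preceq> D" if "D x \<noteq> 0" for x
      using pos [OF that] rank1_below_positive_op [OF D] by (auto simp: P_def rank1_positive_ops)
    have par: "\<exists>c. D x = c *\<^sub>C D x0" for x
    proof (cases "D x = 0")
      case True
      then show ?thesis by (intro exI [of _ 0]) simp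
    next
      case False
      have "A + P x \<preceq> A + P x0 \<or> A + P x0 \<preceq> A + P x"
        using chain P [OF False] P [OF x0] A unfolding chain_interval_def
        by (metis B_eq op_le_cancel op_le_plus plus_positive_ops)
      then have "P x \<preceq> P x0 \<or> P x0 \<preceq> P x" by (simp add: op_le_cancel)
      then show ?thesis
      proof
        assume "P x \<preceq> P x0"
        then show ?thesis unfolding P_def by (rule rank1_le_imp_parallel) (simp add: pos False)
      next
        assume "P x0 \<preceq> P x"
        then have "\<exists>c. D x0 = c *\<^sub>C D x"
          unfolding P_def by (rule rank1_le_imp_parallel) (simp add: pos x0)
        then show ?thesis using parallel_sym x0 by blast
      qed
    qed
    have "\<exists>s\<ge>0. D = rank1 s (D x0)"
    proof (rule rank1_if_kernel [OF D])
      fix v assume v: "cinner v (D x0) = 0"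
      obtain c where c: "D v = c *\<^sub>C D x0" using par by blast
      have "cinner (D v) x0 = 0" using v positive_ops_symmetric [OF D] by simp
      then have "c * of_real (inner (D x0) x0) = 0"
        by (simp add: c cinner_scaleC_left positive_ops_form [OF D])
      then show "D v = 0" using pos [OF x0] by (simp add: c)
    qed
    then show ?thesis by blast
  qed
  then show ?thesis using B_eq rank1_eq_unit by metis
qed

section \<open>Order automorphisms along rank-one directions\<close>

locale order_automorphism =
  fixes \<phi> :: "('a::chilbert_space \<Rightarrow> 'a) \<Rightarrow> ('a \<Rightarrow> 'a)"
  assumes bij: "bij_betw \<phi> positive_ops positive_ops"
    and order: "A \<in> positive_ops \<Longrightarrow> B \<in> positive_ops \<Longrightarrow> A \<preceq> B \<longleftrightarrow> \<phi> A \<preceq> \<phi> B"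
begin

abbreviation "\<phi>' \<equiv> inv_into positive_ops \<phi>"

lemma mem: "A \<in> positive_ops \<Longrightarrow> \<phi> A \<in> positive_ops"
  using bij bij_betwE by blast

lemma inverse_mem: "A \<in> positive_ops \<Longrightarrow> \<phi>' A \<in> positive_ops"
  using bij by (metis bij_betw_def inv_into_into)

lemma inverse_right: "A \<in> positive_ops \<Longrightarrow> \<phi> (\<phi>' A) = A"
  by (rule bij_betw_inv_into_right [OF bij])

lemma inverse_left: "A \<in> positive_ops \<Longrightarrow> \<phi>' (\<phi> A) = A"
  by (rule bij_betw_inv_into_left [OF bij])

lemma inj: "A \<in> positive_ops \<Longrightarrow> B \<in> positive_ops \<Longrightarrow> \<phi> A = \<phi> B \<Longrightarrow> A = B"
  by (metis inverse_left)

lemma inverse: "order_automorphism \<phi>'"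
proof
  show "bij_betw \<phi>' positive_ops positive_ops" by (rule bij_betw_inv_into [OF bij])
  fix A B :: "'a \<Rightarrow> 'a" assume "A \<in> positive_ops" "B \<in> positive_ops"
  then show "A \<preceq> B \<longleftrightarrow> \<phi>' A \<preceq> \<phi>' B"
    by (metis inverse_mem inverse_right order)
qed

lemma zero: "\<phi> 0 = 0"
proof (rule op_le_antisym)
  have "0 \<preceq> \<phi>' 0"
    using op_le_plus [of "\<phi>' 0" 0] inverse_mem [OF zero_positive_ops] by simp
  then show "\<phi> 0 \<preceq> 0"
    using order inverse_mem inverse_right zero_positive_ops by metis
  show "0 \<preceq> \<phi> 0"
    using op_le_plus [of "\<phi> 0" 0] mem [OF zero_positive_ops] by simp
qed (simp_all add: mem zero_positive_ops)

lemma plus_rank1_unit: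
  assumes A: "A \<in> positive_ops"
  shows "\<exists>z. \<phi> (A + rank1 1 x) = \<phi> A + rank1 1 z"
proof (rule rank1_if_chain_interval)
  have B: "A + rank1 1 x \<in> positive_ops"
    by (simp add: A plus_positive_ops rank1_positive_ops)
  then show "\<phi> (A + rank1 1 x) \<in> positive_ops" by (rule mem)
  show "\<phi> A \<in> positive_ops" using A by (rule mem)
  show "\<phi> A \<preceq> \<phi> (A + rank1 1 x)"
    using order [OF A B] op_le_plus rank1_positive_ops by (metis zero_le_one)
  have *: "\<exists>C'\<in>positive_ops. \<phi> C' = C \<and> A \<preceq> C' \<and> C' \<preceq> A + rank1 1 x"
    if "C \<in> positive_ops" "\<phi> A \<preceq> C" "C \<preceq> \<phi> (A + rank1 1 x)" for C
    using that order A B by (intro bexI [of _ "\<phi>' C"]) (simp_all add: inverse_mem inverse_right)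
  show "chain_interval (\<phi> A) (\<phi> (A + rank1 1 x))"
    unfolding chain_interval_def
  proof (intro ballI impI)
    fix C D assume "C \<in> positive_ops" "D \<in> positive_ops" "\<phi> A \<preceq> C" "C \<preceq> \<phi> (A + rank1 1 x)"
      "\<phi> A \<preceq> D" "D \<preceq> \<phi> (A + rank1 1 x)"
    then obtain C' D' where C': "C' \<in> positive_ops" "\<phi> C' = C" "A \<preceq> C'" "C' \<preceq> A + rank1 1 x"
      and D': "D' \<in> positive_ops" "\<phi> D' = D" "A \<preceq> D'" "D' \<preceq> A + rank1 1 x"
      using * by metis
    then have "C' \<preceq> D' \<or> D' \<preceq> C'"
      using chain_interval_rank1 [OF A, of x] unfolding chain_interval_def by blast
    then show "C \<preceq> D \<or> D \<preceq> C" using order C' D' by metis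
  qed
qed

text \<open>
  The vector is determined only up to a factor of modulus one; the choice made here is arbitrary and
  in general not linear. Fixing the phases coherently is the task of the linearisation below.
\<close>

definition image_vec :: "'a \<Rightarrow> 'a" where
  "image_vec x = (SOME z. \<phi> (rank1 1 x) = rank1 1 z)"

lemma image_vec: "\<phi> (rank1 1 x) = rank1 1 (image_vec x)"
proof -
  have "\<exists>z. \<phi> (rank1 1 x) = rank1 1 z"
    using plus_rank1_unit [OF zero_positive_ops, of x] by (simp add: zero)
  then show ?thesis unfolding image_vec_def by (rule someI_ex)
qed

lemma image_vec_zero [simp]: "image_vec 0 = 0"
  using image_vec [of 0] by (simp add: zero)

lemma image_vec_nonzero:
  assumes "x \<noteq> 0"
  shows "image_vec x \<noteq> 0"
proof
  assume "image_vec x = 0"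
  then have "\<phi> (rank1 1 x) = \<phi> 0" by (simp add: image_vec zero)
  then have "rank1 1 x = 0"
    using inj [OF rank1_positive_ops [of 1 x] zero_positive_ops] by simp
  then show False using assms by simp
qed

text \<open>
  The image of a ray through \<open>0\<close> is unbounded: for \<open>c \<ge> 1\<close> the inverse of \<open>\<phi>\<close> sends
  \<open>rank1 c (image_vec x)\<close> to a rank-one operator above \<open>rank1 1 x\<close>, hence to a point of the ray.
\<close>

lemma image_ray_surj:
  assumes x: "x \<noteq> 0" and c: "1 \<le> c"
  shows "\<exists>\<tau>>0. \<phi> (rank1 \<tau> x) = rank1 c (image_vec x)"
proof -
  interpret inv: order_automorphism \<phi>' by (rule inverse)
  define Y where "Y = rank1 c (image_vec x)"
  have Y: "Y \<in> positive_ops" using c by (simp add: Y_def rank1_positive_ops)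
  have "Y = rank1 1 (sqrt c *\<^sub>R image_vec x)" using c by (simp add: Y_def rank1_scaleR)
  then obtain q where q: "\<phi>' Y = rank1 1 q" using inv.image_vec by metis
  have "\<phi> (rank1 1 x) \<preceq> \<phi> (\<phi>' Y)"
    using rank1_le_mono [OF c] by (simp add: inverse_right [OF Y] image_vec) (simp add: Y_def)
  then have le: "rank1 1 x \<preceq> rank1 1 q"
    using order q by (metis rank1_positive_ops zero_le_one)
  then obtain d where "x = d *\<^sub>C q" using rank1_le_imp_parallel by (metis zero_less_one)
  then obtain e where e: "q = e *\<^sub>C x" using parallel_sym x by blast
  have "q \<noteq> 0" using \<open>x = d *\<^sub>C q\<close> x by auto
  then have "0 < (cmod e)\<^sup>2" using e by auto
  moreover have "\<phi> (rank1 ((cmod e)\<^sup>2) x) = Y"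
    using inverse_right [OF Y] q by (simp add: e rank1_scaleC)
  ultimately show ?thesis unfolding Y_def by blast
qed

text \<open>
  The direction in which \<open>\<phi>\<close> moves along a half-line \<open>A + t \<cdot> rank1 x\<close> does not depend on its
  origin \<open>A\<close>: the image of the half-line dominates the image of the half-line from \<open>0\<close>, which is
  unbounded in the direction of \<open>image_vec x\<close>, whereas \<open>\<phi> A + rank1 z\<close> is bounded by \<open>\<phi> A\<close> on the
  orthogonal complement of \<open>z\<close>.
\<close>

lemma plus_rank1:
  assumes A: "A \<in> positive_ops" and t: "0 \<le> t"
  shows "\<exists>s\<ge>0. \<phi> (A + rank1 t x) = \<phi> A + rank1 s (image_vec x)"
proof (cases "t = 0 \<or> x = 0")
  case True
  then show ?thesis by (auto intro!: exI [of _ 0])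
next
  case False
  then have t: "0 < t" and x: "x \<noteq> 0" using t by auto
  have mem': "A + rank1 s x \<in> positive_ops" if "0 < s" for s
    using that by (simp add: A plus_positive_ops rank1_positive_ops)
  have ex: "\<exists>z. \<phi> (A + rank1 s x) = \<phi> A + rank1 1 z" if "0 < s" for s
    using plus_rank1_unit [OF A, of "sqrt s *\<^sub>R x"] that by (simp add: rank1_scaleR)
  obtain z where z: "\<phi> (A + rank1 t x) = \<phi> A + rank1 1 z" using ex [OF t] by blast
  have "z \<noteq> 0"
  proof
    assume "z = 0"
    then have "A + rank1 t x = A" using z inj [OF mem' [OF t] A] by simp
    then show False using x t by simp
  qed
  have "\<exists>k. image_vec x = k *\<^sub>C z"
  proof (rule in_span_if_orthogonal)
    fix v assume v: "cinner v z = 0"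
    \<comment> \<open>Compare at the point where the ray from \<open>0\<close> has reached \<open>c \<cdot> rank1 (image_vec x)\<close>. The operators
      \<open>rank1 1 z\<close> and \<open>rank1 1 z'\<close> are comparable, so \<open>v\<close> is orthogonal to \<open>z'\<close> too.\<close>
    have bound: "c * (cmod (cinner v (image_vec x)))\<^sup>2 \<le> inner (\<phi> A v) v" if c: "1 \<le> c" for c
    proof -
      obtain \<tau> where \<tau>: "0 < \<tau>" "\<phi> (rank1 \<tau> x) = rank1 c (image_vec x)"
        using image_ray_surj [OF x c] by blast
      obtain z' where z': "\<phi> (A + rank1 \<tau> x) = \<phi> A + rank1 1 z'" using ex [OF \<tau>(1)] by blast
      have "cinner v z' = 0"
      proof (cases "\<tau> \<le> t")
        case True
        then have "\<phi> (A + rank1 \<tau> x) \<preceq> \<phi> (A + rank1 t x)"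
          using order mem' \<tau>(1) t by (metis op_le_cancel rank1_le_mono)
        then have "rank1 1 z' \<preceq> rank1 1 z" by (simp add: z z' op_le_cancel)
        then obtain k where "z' = k *\<^sub>C z" using rank1_le_imp_parallel by (metis zero_less_one)
        then show ?thesis using v by (simp add: cinner_scaleC_right)
      next
        case False
        then have "\<phi> (A + rank1 t x) \<preceq> \<phi> (A + rank1 \<tau> x)"
          using order mem' \<tau>(1) t by (metis op_le_cancel rank1_le_mono linear)
        then have "rank1 1 z \<preceq> rank1 1 z'" by (simp add: z z' op_le_cancel)
        then obtain k where "z = k *\<^sub>C z'" using rank1_le_imp_parallel by (metis zero_less_one)
        then show ?thesis using v \<open>z \<noteq> 0\<close> by (auto simp: cinner_scaleC_right)
      qed
      moreover have "rank1 \<tau> x \<preceq> A + rank1 \<tau> x"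
        using op_le_plus [OF A, of "rank1 \<tau> x"] by (simp add: add.commute)
      then have "rank1 c (image_vec x) \<preceq> \<phi> A + rank1 1 z'"
        using order [of "rank1 \<tau> x" "A + rank1 \<tau> x"] \<tau> mem' by (simp add: rank1_positive_ops z')
      from op_leD [OF this, of v]
      have "c * (cmod (cinner v (image_vec x)))\<^sup>2
          \<le> inner (\<phi> A v) v + (cmod (cinner v z'))\<^sup>2"
        by (simp add: rank1_inner inner_add_left)
      ultimately show ?thesis by simp
    qed
    show "cinner v (image_vec x) = 0"
    proof (rule ccontr)
      define m where "m = (cmod (cinner v (image_vec x)))\<^sup>2"
      assume "cinner v (image_vec x) \<noteq> 0"
      then have m: "0 < m" by (simp add: m_def)
      have "0 \<le> inner (\<phi> A v) v" using mem [OF A] by (rule positive_ops_form_nonneg)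
      then have "(inner (\<phi> A v) v / m + 1) * m \<le> inner (\<phi> A v) v"
        using m unfolding m_def by (intro bound) simp
      then show False using m by (simp add: distrib_right)
    qed
  qed
  then obtain k where "z = k *\<^sub>C image_vec x"
    using parallel_sym image_vec_nonzero [OF x] by blast
  then show ?thesis using z by (intro exI [of _ "(cmod k)\<^sup>2"]) (simp add: rank1_scaleC)
qed

text \<open>
  Parallel images are comparable, so the originals are comparable.
\<close>

lemma image_vec_parallelD:
  assumes "image_vec x = c *\<^sub>C image_vec y" "x \<noteq> 0"
  shows "\<exists>d. x = d *\<^sub>C y"
proof -
  have "\<phi> (rank1 1 x) = rank1 ((cmod c)\<^sup>2) (image_vec y)"
    by (simp add: image_vec assms rank1_scaleC)
  then have "\<phi> (rank1 1 x) \<preceq> \<phi> (rank1 1 y) \<or> \<phi> (rank1 1 y) \<preceq> \<phi> (rank1 1 x)"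
    using rank1_le_mono linear by (metis image_vec)
  then have "rank1 1 x \<preceq> rank1 1 y \<or> rank1 1 y \<preceq> rank1 1 x"
    using order rank1_positive_ops by (metis zero_le_one)
  then show ?thesis
  proof
    assume "rank1 1 x \<preceq> rank1 1 y"
    then show ?thesis using rank1_le_imp_parallel by (metis zero_less_one)
  next
    assume "rank1 1 y \<preceq> rank1 1 x"
    then obtain d where d: "y = d *\<^sub>C x" using rank1_le_imp_parallel by (metis zero_less_one)
    have "y \<noteq> 0"
    proof
      assume "y = 0"
      then show False using assms image_vec_nonzero by simp
    qed
    then show ?thesis using parallel_sym d by blast
  qed
qed

definition increment :: "('a \<Rightarrow> 'a) \<Rightarrow> 'a \<Rightarrow> real \<Rightarrow> real \<Rightarrow> bool" where
  "increment A x t b \<longleftrightarrow> \<phi> (A + rank1 t x) = \<phi> A + rank1 b (image_vec x)"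

lemma increment_ex: "A \<in> positive_ops \<Longrightarrow> 0 \<le> t \<Longrightarrow> \<exists>b\<ge>0. increment A x t b"
  unfolding increment_def by (rule plus_rank1)

lemma increment_unique:
  "increment A x t b \<Longrightarrow> increment A x t b' \<Longrightarrow> x \<noteq> 0 \<Longrightarrow> b = b'"
  unfolding increment_def using rank1_inj image_vec_nonzero by (metis add_left_cancel)

lemma increment_trans:
  assumes "increment A x s b" "increment (A + rank1 s x) x t c"
  shows "increment A x (s + t) (b + c)"
  using assms by (simp add: increment_def rank1_add add.assoc [symmetric])

text \<open>
  Move from \<open>A\<close> to \<open>A + s \<cdot> rank1 y + t \<cdot> rank1 x\<close> in both orders. Since the images of the
  two directions are linearly independent, opposite sides of the resulting parallelogram agree.
\<close>

lemma increment_shift_iff: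
  assumes A: "A \<in> positive_ops" and s: "0 \<le> s" and t: "0 \<le> t" and par: "\<nexists>c. x = c *\<^sub>C y"
  shows "increment (A + rank1 s y) x t b \<longleftrightarrow> increment A x t b"
proof -
  have x: "x \<noteq> 0" using par by (rule not_parallel_nonzero)
  have As: "A + rank1 s y \<in> positive_ops" and At: "A + rank1 t x \<in> positive_ops"
    using A s t by (simp_all add: plus_positive_ops rank1_positive_ops)
  obtain b1 where b1: "increment A x t b1" using increment_ex [OF A t] by blast
  obtain b2 where b2: "increment (A + rank1 s y) x t b2" using increment_ex [OF As t] by blast
  obtain a1 where a1: "increment A y s a1" using increment_ex [OF A s] by blast
  obtain a2 where a2: "increment (A + rank1 t x) y s a2" using increment_ex [OF At s] by blast
  have "\<phi> A + rank1 a1 (image_vec y) + rank1 b2 (image_vec x)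
      = \<phi> A + rank1 b1 (image_vec x) + rank1 a2 (image_vec y)"
    using a1 a2 b1 b2 unfolding increment_def by (metis add.assoc add.commute)
  then have eq: "rank1 a1 (image_vec y) v + rank1 b2 (image_vec x) v
      = rank1 b1 (image_vec x) v + rank1 a2 (image_vec y) v" for v
    by (auto simp: fun_eq_iff add.assoc)
  have "\<nexists>c. image_vec x = c *\<^sub>C image_vec y" using image_vec_parallelD par x by blast
  then obtain v where v: "cinner v (image_vec y) = 0" "cinner v (image_vec x) \<noteq> 0"
    using orthogonal_witness by blast
  have "rank1 b2 (image_vec x) v = rank1 b1 (image_vec x) v"
    using eq [of v] v(1) by (simp add: rank1_def)
  then have "b2 = b1"
    using v(2) image_vec_nonzero [OF x] by (simp add: rank1_def)
  then show ?thesis using b1 b2 increment_unique x by blast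
qed

end

text \<open>
  In dimension one every increasing bijection of the half-line is an order automorphism; from here
  on there is room for a second direction.
\<close>

locale order_automorphism_dim2 = order_automorphism \<phi>
  for \<phi> :: "('a::chilbert_space \<Rightarrow> 'a) \<Rightarrow> ('a \<Rightarrow> 'a)" +
  assumes dim_gt_1: "(x :: 'a) \<noteq> 0 \<Longrightarrow> \<exists>y. \<nexists>c. y = c *\<^sub>C x"
begin

text \<open>
  Increments along \<open>x\<close> do not change when the origin moves along \<open>x\<close> itself: by the
  parallelogram law, moving along \<open>x\<close> and \<open>y\<close> amounts to moving along \<open>x + y\<close> and \<open>x - y\<close>,
  neither of which is parallel to \<open>x\<close>.
\<close>

lemma increment_shift:
  assumes A: "A \<in> positive_ops" and s: "0 \<le> s" and t: "0 \<le> t" and inc: "increment A x t b"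
  shows "increment (A + rank1 s y) x t b"
proof (cases "x = 0")
  case True
  then show ?thesis by (simp add: increment_def)
next
  case x: False
  have self: "increment (A + rank1 r x) x t b" if r: "0 \<le> r" for r
  proof -
    obtain u where u: "\<nexists>c. u = c *\<^sub>C x" using dim_gt_1 [OF x] by blast
    have par: "\<nexists>c. x = c *\<^sub>C u" using parallel_sym x u by blast
    have par_plus: "\<nexists>c. x = c *\<^sub>C (x + u)"
    proof
      assume "\<exists>c. x = c *\<^sub>C (x + u)"
      then obtain d where "x + u = d *\<^sub>C x" using parallel_sym x by blast
      then have "u = (d - 1) *\<^sub>C x"
        by (metis add_diff_cancel_left' complex_vector.scale_left_diff_distrib scaleC_one)
      then show False using u by blast
    qed
    have par_minus: "\<nexists>c. x = c *\<^sub>C (x - u)"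
    proof
      assume "\<exists>c. x = c *\<^sub>C (x - u)"
      then obtain d where "x - u = d *\<^sub>C x" using parallel_sym x by blast
      then have "u = (1 - d) *\<^sub>C x"
        by (metis diff_diff_eq2 add_diff_cancel_left' complex_vector.scale_left_diff_distrib
            scaleC_one)
      then show False using u by blast
    qed
    \<comment> \<open>Add steps along \<open>x + u\<close> and \<open>x - u\<close>, regroup them as steps along \<open>x\<close> and \<open>u\<close>, and remove the
      step along \<open>u\<close>.\<close>
    have r2: "0 \<le> r / 2" using r by simp
    have "increment (A + rank1 (r / 2) (x + u)) x t b"
      using increment_shift_iff [OF A r2 t par_plus] inc by blast
    then have "increment (A + rank1 (r / 2) (x + u) + rank1 (r / 2) (x - u)) x t b"
      using increment_shift_iff [OF _ r2 t par_minus] A r2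
      by (simp add: plus_positive_ops rank1_positive_ops)
    then have "increment (A + rank1 r x + rank1 r u) x t b"
      using rank1_parallelogram [of "r / 2" x u] by (simp add: add.assoc)
    then show ?thesis
      using increment_shift_iff [OF _ r t par] A r
      by (simp add: plus_positive_ops rank1_positive_ops)
  qed
  show ?thesis
  proof (cases "\<exists>c. y = c *\<^sub>C x")
    case True
    then obtain c where "y = c *\<^sub>C x" by blast
    then show ?thesis using self [of "s * (cmod c)\<^sup>2"] s by (simp add: rank1_scaleC)
  next
    case False
    show ?thesis
    proof (cases "\<exists>c. x = c *\<^sub>C y")
      case True
      then show ?thesis using parallel_sym x False by blast
    next
      case False
      then show ?thesis using increment_shift_iff [OF A s t] inc by blast
    qed
  qed
qed

text \<open>
  By \<open>increment_shift\<close> the increment from \<open>0\<close> is an additive function of the step; being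
  nonnegative, it is monotone and hence linear, and \<open>image_vec\<close> is normalised so that the step \<open>1\<close>
  has the increment \<open>1\<close>.
\<close>

lemma increment_zero:
  assumes t: "0 \<le> t"
  shows "increment 0 x t t"
proof (cases "x = 0")
  case True
  then show ?thesis by (simp add: increment_def)
next
  case x: False
  have "\<exists>f. \<forall>t\<ge>0. 0 \<le> f t \<and> increment 0 x t (f t)"
    using increment_ex [OF zero_positive_ops] by meson
  then obtain f where f: "\<And>t. 0 \<le> t \<Longrightarrow> 0 \<le> f t" "\<And>t. 0 \<le> t \<Longrightarrow> increment 0 x t (f t)"
    by blast
  have add: "f (s + t) = f s + f t" if "0 \<le> s" "0 \<le> t" for s t
  proof -
    have "increment (0 + rank1 s x) x t (f t)"
      using that f(2) by (intro increment_shift) (simp_all add: zero_positive_ops)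
    then have "increment 0 x (s + t) (f s + f t)"
      using increment_trans f(2) that by blast
    then show ?thesis using increment_unique x f(2) that by (metis add_nonneg_nonneg)
  qed
  have one: "f 1 = 1"
  proof -
    have "increment 0 x 1 1" by (simp add: increment_def zero image_vec)
    then show ?thesis using increment_unique x f(2) by (metis zero_le_one)
  qed
  have mult: "f (real n * t) = real n * f t" if "0 \<le> t" for n t
  proof (induction n)
    case 0
    then show ?case using add [of 0 0] by simp
  next
    case (Suc n)
    then show ?case using add [of t "real n * t"] that by (simp add: algebra_simps)
  qed
  have nat: "f (real n) = real n" for n using mult [of 1 n] one by simp
  have mono: "f s \<le> f t" if "0 \<le> s" "s \<le> t" for s t
    using add [of s "t - s"] f(1) [of "t - s"] that by simp
  have close: "real n * \<bar>f t - t\<bar> \<le> 1" for n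
  proof -
    define k where "k = nat \<lfloor>real n * t\<rfloor>"
    have k: "real k \<le> real n * t" "real n * t \<le> real (Suc k)"
      using t by (simp_all add: k_def) linarith+
    have "f (real k) \<le> f (real n * t)" "f (real n * t) \<le> f (real (Suc k))"
      using k t by (auto intro!: mono)
    then have "real k \<le> real n * f t" "real n * f t \<le> real (Suc k)"
      by (simp_all only: nat mult [OF t])
    then have "\<bar>real n * f t - real n * t\<bar> \<le> 1" using k by simp
    then show ?thesis by (simp add: abs_mult right_diff_distrib [symmetric])
  qed
  have "f t = t"
  proof (rule ccontr)
    assume "f t \<noteq> t"
    then have "0 < \<bar>f t - t\<bar>" by simp
    then obtain n where "1 < real n * \<bar>f t - t\<bar>" using reals_Archimedean3 by blast
    then show False using close [of n] by simp
  qed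
  then show ?thesis using f(2) [OF t] by simp
qed

lemma image_rank1: "0 \<le> t \<Longrightarrow> \<phi> (rank1 t x) = rank1 t (image_vec x)"
  using increment_zero [of t x] by (simp add: increment_def zero)

lemma sum_list_rank1_positive_ops: "sum_list (map (rank1 1) xs) \<in> positive_ops"
  by (induction xs)
    (simp_all only: list.map sum_list.Nil sum_list.Cons zero_positive_ops plus_positive_ops
      rank1_positive_ops zero_le_one)

lemma increment_sum_list: "increment (sum_list (map (rank1 1) ys)) x 1 1"
proof (induction ys)
  case Nil
  show ?case using increment_zero [of 1 x] by (simp only: list.map sum_list.Nil zero_le_one)
next
  case (Cons y ys)
  then have "increment (sum_list (map (rank1 1) ys) + rank1 1 y) x 1 1"
    by (intro increment_shift sum_list_rank1_positive_ops) simp_all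
  then show ?case by (simp only: list.map sum_list.Cons add.commute)
qed

lemma image_sum_list:
  "\<phi> (sum_list (map (rank1 1) xs)) = sum_list (map (\<lambda>x. rank1 1 (image_vec x)) xs)"
proof (induction xs)
  case Nil
  show ?case by (simp only: list.map sum_list.Nil zero)
next
  case (Cons x xs)
  then show ?case
    using increment_sum_list [of xs x]
    by (simp only: list.map sum_list.Cons increment_def add.commute)
qed

end

section \<open>Linearising the induced map on vectors\<close>

text \<open>
  The analogue of \<open>in_span_if_orthogonal\<close> for two vectors, reduced to it by subtracting
  projections onto \<open>E\<close>.
\<close>

lemma span2_if_orthogonal:
  assumes "\<And>v. cinner v E = 0 \<Longrightarrow> cinner v F = 0 \<Longrightarrow> cinner v w = 0"
  shows "\<exists>\<alpha> \<beta>. w = \<alpha> *\<^sub>C F + \<beta> *\<^sub>C E"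
proof -
  have proj: "\<exists>k. cinner E (z - k *\<^sub>C E) = 0" for z
  proof (cases "E = 0")
    case False
    then show ?thesis
      by (intro exI [of _ "cnj (cinner E z / cinner E E)"]) (simp add: cinner_simps)
  qed simp
  obtain k where k: "cinner E (F - k *\<^sub>C E) = 0" using proj by blast
  obtain m where m: "cinner E (w - m *\<^sub>C E) = 0" using proj by blast
  have "\<exists>\<alpha>. w - m *\<^sub>C E = \<alpha> *\<^sub>C (F - k *\<^sub>C E)"
  proof (rule in_span_if_orthogonal)
    fix v assume v: "cinner v (F - k *\<^sub>C E) = 0"
    obtain n where n: "cinner E (v - n *\<^sub>C E) = 0" using proj by blast
    define u where "u = v - n *\<^sub>C E"
    have uE: "cinner u E = 0" using n cinner_commute [of u E] by (simp add: u_def)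
    have v_eq: "v = u + n *\<^sub>C E" by (simp add: u_def)
    have "cinner u F = 0"
      using v k uE by (simp add: v_eq cinner_add_left cinner_scaleC_left) (simp add: cinner_simps)
    then have "cinner u w = 0" using assms uE by blast
    then show "cinner v (w - m *\<^sub>C E) = 0"
      using m uE by (simp add: v_eq cinner_add_left cinner_scaleC_left) (simp add: cinner_simps)
  qed
  then obtain \<alpha> where "w - m *\<^sub>C E = \<alpha> *\<^sub>C (F - k *\<^sub>C E)" by blast
  then have "w = \<alpha> *\<^sub>C F + (m - \<alpha> * k) *\<^sub>C E"
    by (simp add: complex_vector.scale_right_diff_distrib complex_vector.scale_left_diff_distrib
        scaleC_scaleC algebra_simps)
  then show ?thesis by blast
qed

text \<open>
  The two alternatives of the dichotomy below overlap when \<open>x\<close> is a multiple of \<open>e\<close>; there they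
  agree on the rank-one operator.
\<close>

lemma rank1_eq_if_swapped:
  assumes "E \<noteq> 0" and eq: "\<And>v. cinner v E *\<^sub>C a = cinner v b *\<^sub>C E"
  shows "rank1 t a = rank1 t b"
proof -
  define k where "k = cinner E b / cinner E E"
  have a: "a = k *\<^sub>C E"
  proof -
    have "a = (1 / cinner E E) *\<^sub>C (cinner E E *\<^sub>C a)"
      using assms(1) by (simp add: scaleC_scaleC scaleC_one)
    then show ?thesis by (simp add: eq scaleC_scaleC k_def)
  qed
  have "b = cnj k *\<^sub>C E"
  proof (rule cinner_eqI)
    fix v
    have "(cinner v E * k) *\<^sub>C E = cinner v b *\<^sub>C E"
      using eq [of v] by (simp add: a scaleC_scaleC)
    then show "cinner v b = cinner v (cnj k *\<^sub>C E)"
      using assms(1) by (simp add: cinner_scaleC_right mult.commute)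
  qed
  then show ?thesis by (simp add: a rank1_scaleC)
qed

context order_automorphism_dim2
begin

definition G :: "'a \<Rightarrow> 'a \<Rightarrow> 'a" where
  "G x = rank1 1 (image_vec x)"

lemma G_apply: "G x v = cinner v (image_vec x) *\<^sub>C image_vec x"
  by (simp add: G_def rank1_def)

text \<open>
  This transfers to \<open>G\<close> every identity between sums of squares \<open>rank1 1 x\<close> in which both sides have
  nonnegative coefficients. The algebra of \<open>polar\<close> below consists of such identities.
\<close>

lemma G_sum_list_cong:
  assumes "sum_list (map (rank1 1) xs) = sum_list (map (rank1 1) ys)"
  shows "sum_list (map G xs) = sum_list (map G ys)"
  using image_sum_list [of xs] image_sum_list [of ys] assms by (simp add: G_def [abs_def])

lemma G_scaleC: "G (c *\<^sub>C x) = rank1 ((cmod c)\<^sup>2) (image_vec x)"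
  using image_rank1 [of "(cmod c)\<^sup>2" x] image_vec [of "c *\<^sub>C x"] by (simp add: G_def rank1_scaleC)

lemma G_scaleC_apply: "G (c *\<^sub>C x) v = (cmod c)\<^sup>2 *\<^sub>R G x v"
  unfolding G_scaleC by (simp add: G_def rank1_def)

lemma G_minus: "G (- x) = G x"
  using G_scaleC [of "- 1" x] by (simp add: G_def scaleC_one)

text \<open>
  For \<open>G x = rank1 1 (T x)\<close> with a real-linear \<open>T\<close>, this is
  \<open>v \<mapsto> 2 (\<langle>v, T y\<rangle> T x + \<langle>v, T x\<rangle> T y)\<close>.
\<close>

definition polar :: "'a \<Rightarrow> 'a \<Rightarrow> 'a \<Rightarrow> 'a" where
  "polar x y v = G (x + y) v - G (x - y) v"

lemma polar_commute: "polar x y = polar y x"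
  using G_minus [of "x - y"] by (simp add: polar_def fun_eq_iff add.commute)

lemma polar_add_left: "polar (x + x') y v = polar x y v + polar x' y v"
proof -
  have "sum_list (map (rank1 1) [x + x' + y, x - y, x' - y])
      = sum_list (map (rank1 1) [x + x' - y, x + y, x' + y])"
    by (simp add: rank1_def fun_eq_iff cinner_simps scaleC_add_right scaleC_add_left
        complex_vector.scale_right_diff_distrib complex_vector.scale_left_diff_distrib)
  from fun_cong [OF G_sum_list_cong [OF this], of v] show ?thesis
    by (simp add: polar_def algebra_simps)
qed

lemma polar_minus_left: "polar (- x) y v = - polar x y v"
  using G_minus [of "x - y"] G_minus [of "x + y"] by (simp add: polar_def)

lemma polar_scaleR_left: "polar (r *\<^sub>R x) y v = r *\<^sub>R polar x y v"
proof -
  have nonneg: "polar (r *\<^sub>R x) y v = r *\<^sub>R polar x y v" if r: "0 \<le> r" for r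
  proof -
    have G_sqrt: "G (sqrt r *\<^sub>R z) v = r *\<^sub>R G z v" for z
      using r by (simp add: scaleR_scaleC [of "sqrt r"] G_scaleC_apply)
    have "rank1 1 (r *\<^sub>R x + y) + rank1 r (x - y) = rank1 1 (r *\<^sub>R x - y) + rank1 r (x + y)"
      by (simp add: rank1_def fun_eq_iff cinner_simps scaleC_add_right scaleC_add_left
          complex_vector.scale_right_diff_distrib complex_vector.scale_left_diff_distrib
          scaleR_scaleC scaleC_scaleC algebra_simps)
    then have "sum_list (map (rank1 1) [r *\<^sub>R x + y, sqrt r *\<^sub>R (x - y)])
        = sum_list (map (rank1 1) [r *\<^sub>R x - y, sqrt r *\<^sub>R (x + y)])"
      using r by (simp add: rank1_scaleR fun_eq_iff)
    from fun_cong [OF G_sum_list_cong [OF this], of v]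
    have "G (r *\<^sub>R x + y) v + r *\<^sub>R G (x - y) v = G (r *\<^sub>R x - y) v + r *\<^sub>R G (x + y) v"
      by (simp add: G_sqrt del: scaleR_diff_right scaleR_add_right)
    then show ?thesis
      by (simp add: polar_def scaleR_diff_right) (simp add: algebra_simps)
  qed
  show ?thesis
  proof (cases "0 \<le> r")
    case False
    then show ?thesis using nonneg [of "- r"] polar_minus_left [of "r *\<^sub>R x" y v] by simp
  qed (rule nonneg)
qed

lemma polar_add_right: "polar x (y + y') v = polar x y v + polar x y' v"
  using polar_add_left polar_commute by metis

lemma polar_scaleR_right: "polar x (r *\<^sub>R y) v = r *\<^sub>R polar x y v"
  using polar_scaleR_left polar_commute by metis

lemma polar_ii: "polar (\<i> *\<^sub>C x) y v = - polar x (\<i> *\<^sub>C y) v"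
proof -
  have "polar (\<i> *\<^sub>C u) (\<i> *\<^sub>C y) v = polar u y v" for u
    using G_scaleC_apply [of \<i>]
    by (simp add: polar_def complex_vector.scale_right_distrib [symmetric]
        complex_vector.scale_right_diff_distrib [symmetric])
  from this [of "\<i> *\<^sub>C x"] show ?thesis
    by (simp add: scaleC_scaleC polar_minus_left scaleC_one)
qed

lemma G_add: "G (x + y) v = G x v + (1 / 2) *\<^sub>R polar x y v + G y v"
proof -
  have "sum_list (map (rank1 1) [x + y, x - y]) = sum_list (map (rank1 1) [x, x, y, y])"
    using rank1_parallelogram [of 1 x y] rank1_add [of 1 1 x] rank1_add [of 1 1 y]
    by (simp add: fun_eq_iff add.assoc)
  from fun_cong [OF G_sum_list_cong [OF this], of v]
  have "G (x + y) v + G (x - y) v = 2 *\<^sub>R G x v + 2 *\<^sub>R G y v"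
    by (simp add: scaleR_2)
  then have "2 *\<^sub>R G (x + y) v = 2 *\<^sub>R G x v + polar x y v + 2 *\<^sub>R G y v"
    by (simp add: polar_def scaleR_2 algebra_simps)
  then have "(1 / 2) *\<^sub>R (2 *\<^sub>R G (x + y) v)
      = (1 / 2) *\<^sub>R (2 *\<^sub>R G x v + polar x y v + 2 *\<^sub>R G y v)"
    by simp
  then show ?thesis by (simp add: scaleR_add_right)
qed

text \<open>
  The form of \<open>G (x + s c e)\<close> at \<open>v\<close> is a nonnegative polynomial in the real variable \<open>s\<close>,
  \<open>\<bar>\<langle>v, F\<rangle>\<bar>\<^sup>2 + s h v + s\<^sup>2 \<bar>c\<bar>\<^sup>2 \<bar>\<langle>v, E\<rangle>\<bar>\<^sup>2\<close>. If \<open>v\<close> is orthogonal to \<open>F\<close> or to \<open>E\<close>, its constant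
  or its quadratic term is missing, and then the linear one has to vanish too. At \<open>s = 1\<close> this
  places \<open>image_vec (x + c e)\<close> in the span of \<open>E\<close> and \<open>F\<close>, with coefficients of modulus
  \<open>\<bar>c\<bar>\<close> and \<open>1\<close>.
\<close>

lemma image_vec_line:
  assumes par: "\<nexists>c. x = c *\<^sub>C e" and e: "e \<noteq> 0"
  shows "\<exists>\<beta>. cmod \<beta> = cmod c \<and> G (x + c *\<^sub>C e) = rank1 1 (image_vec x + \<beta> *\<^sub>C image_vec e)"
proof -
  define E F w where "E = image_vec e" and "F = image_vec x"
    and "w = (\<lambda>s::real. image_vec (x + s *\<^sub>R c *\<^sub>C e))"
  define h where "h v = inner (polar x (c *\<^sub>C e) v) v / 2" for v
  have x: "x \<noteq> 0" using par by (rule not_parallel_nonzero)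
  have form: "(cmod (cinner v (w s)))\<^sup>2
      = (cmod (cinner v F))\<^sup>2 + s * h v + s\<^sup>2 * (cmod c)\<^sup>2 * (cmod (cinner v E))\<^sup>2" for v s
  proof -
    have "G (s *\<^sub>R c *\<^sub>C e) v = (s\<^sup>2 * (cmod c)\<^sup>2) *\<^sub>R G e v"
      using G_scaleC_apply [of "of_real s * c" e v]
      by (simp add: scaleR_scaleC scaleC_scaleC norm_mult power_mult_distrib)
    then have "inner (G (x + s *\<^sub>R c *\<^sub>C e) v) v
        = inner (G x v) v + s * h v + s\<^sup>2 * (cmod c)\<^sup>2 * inner (G e v) v"
      by (simp add: G_add polar_scaleR_right inner_add_left h_def)
    then show ?thesis by (simp add: G_def rank1_inner w_def E_def F_def)
  qed
  have indep: "\<nexists>k. F = k *\<^sub>C E" "\<nexists>k. E = k *\<^sub>C F"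
    using image_vec_parallelD par x parallel_sym image_vec_nonzero e unfolding E_def F_def by metis+
  have h_F: "h v = 0" if v: "cinner v F = 0" for v
  proof -
    define K where "K = (cmod c)\<^sup>2 * (cmod (cinner v E))\<^sup>2"
    have le: "0 \<le> s * h v + s\<^sup>2 * K" for s
      using form [of v s] v zero_le_power2 [of "cmod (cinner v (w s))"]
      by (simp add: K_def mult.assoc)
    have K: "0 \<le> K" by (simp add: K_def)
    \<comment> \<open>The summand \<open>1\<close> keeps the denominator away from \<open>0\<close>.\<close>
    define d where "d = h v / (K + 1)"
    have h: "h v = d * (K + 1)" using K by (simp add: d_def)
    have "0 \<le> - d\<^sup>2"
      using le [of "- d"] by (simp add: h algebra_simps power2_eq_square)
    then show ?thesis by (simp add: h)
  qed
  have h_E: "h v = 0" if v: "cinner v E = 0" for v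
  proof (rule ccontr)
    assume h: "h v \<noteq> 0"
    define m where "m = (cmod (cinner v F))\<^sup>2"
    have "0 \<le> m + s * h v" for s
      using form [of v s] v zero_le_power2 [of "cmod (cinner v (w s))"] by (simp add: m_def)
    from this [of "- (m + 1) / h v"] show False using h by simp
  qed
  have "\<exists>\<alpha> \<beta>. w 1 = \<alpha> *\<^sub>C F + \<beta> *\<^sub>C E"
  proof (rule span2_if_orthogonal)
    fix v assume "cinner v E = 0" "cinner v F = 0"
    then have "(cmod (cinner v (w 1)))\<^sup>2 = 0" using form [of v 1] h_F [of v] by simp
    then show "cinner v (w 1) = 0" by simp
  qed
  then obtain \<alpha> \<beta> where w1: "w 1 = \<alpha> *\<^sub>C F + \<beta> *\<^sub>C E" by blast
  have \<alpha>: "cmod \<alpha> = 1"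
  proof -
    obtain v where v: "cinner v E = 0" "cinner v F \<noteq> 0"
      using orthogonal_witness indep(1) by blast
    then have "(cmod \<alpha>)\<^sup>2 = 1"
      using form [of v 1] h_E [of v] by (simp add: w1 cinner_simps norm_mult power_mult_distrib)
    then show ?thesis by (simp add: power2_eq_1_iff) (smt (verit) norm_ge_zero)
  qed
  have \<beta>: "cmod \<beta> = cmod c"
  proof -
    obtain v where v: "cinner v F = 0" "cinner v E \<noteq> 0"
      using orthogonal_witness indep(2) by blast
    then have "(cmod \<beta>)\<^sup>2 = (cmod c)\<^sup>2"
      using form [of v 1] h_F [of v] by (simp add: w1 cinner_simps norm_mult power_mult_distrib)
    then show ?thesis by simp
  qed
  have "w 1 = \<alpha> *\<^sub>C (F + (\<beta> / \<alpha>) *\<^sub>C E)"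
    using \<alpha> by (auto simp: w1 scaleC_add_right scaleC_scaleC)
  then have "G (x + c *\<^sub>C e) = rank1 1 (F + (\<beta> / \<alpha>) *\<^sub>C E)"
    using \<alpha> by (simp add: G_def w_def rank1_scaleC)
  moreover have "cmod (\<beta> / \<alpha>) = cmod c" using \<alpha> \<beta> by (simp add: norm_divide)
  ultimately show ?thesis unfolding E_def F_def by blast
qed

text \<open>
  The part of \<open>polar x e / 2\<close> that is complex linear in \<open>x\<close>. For \<open>G x = rank1 1 (T x)\<close> it is
  \<open>v \<mapsto> \<langle>v, T e\<rangle> T x\<close> if \<open>T\<close> is linear and \<open>v \<mapsto> \<langle>v, T x\<rangle> T e\<close> if \<open>T\<close> is conjugate-linear.
\<close>

definition cross :: "'a \<Rightarrow> 'a \<Rightarrow> 'a \<Rightarrow> 'a" where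
  "cross e x v = (1 / 4) *\<^sub>R (polar x e v - \<i> *\<^sub>C polar (\<i> *\<^sub>C x) e v)"

lemma cross_add: "cross e (x + y) v = cross e x v + cross e y v"
  by (simp add: cross_def scaleC_add_right polar_add_left algebra_simps)

lemma cross_scaleC: "cross e (c *\<^sub>C x) v = c *\<^sub>C cross e x v"
proof -
  have real: "cross e (r *\<^sub>R x) v = r *\<^sub>R cross e x v" for r x
  proof -
    have "\<i> *\<^sub>C r *\<^sub>R x = r *\<^sub>R \<i> *\<^sub>C x" for x :: 'a
      by (simp add: scaleR_scaleC scaleC_scaleC mult.commute)
    then show ?thesis
      by (simp add: cross_def polar_scaleR_left scaleR_diff_right mult.commute)
  qed
  have ii: "cross e (\<i> *\<^sub>C x) v = \<i> *\<^sub>C cross e x v"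
  proof -
    have "\<i> *\<^sub>C r *\<^sub>R x = r *\<^sub>R \<i> *\<^sub>C x" for r and x :: 'a
      by (simp add: scaleR_scaleC scaleC_scaleC mult.commute)
    then show ?thesis
      by (simp add: cross_def scaleC_scaleC scaleC_one polar_minus_left
          complex_vector.scale_right_diff_distrib add.commute)
  qed
  have split: "c *\<^sub>C y = Re c *\<^sub>R y + Im c *\<^sub>R \<i> *\<^sub>C y" for y :: 'a
  proof -
    have "c = of_real (Re c) + of_real (Im c) * \<i>"
      by (simp add: complex_eq_iff)
    then show ?thesis
      by (metis scaleC_add_left scaleC_scaleC scaleR_scaleC)
  qed
  show ?thesis by (simp add: split cross_add real ii)
qed

text \<open>
  For independent \<open>x\<close> and \<open>e\<close>, \<open>polar x (c e)\<close> is given by a coefficient \<open>b c\<close> that is real-linear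
  in \<open>c\<close> and has modulus \<open>\<bar>c\<bar>\<close>. A real-linear isometry of the complex plane is a rotation or a
  reflection, \<open>b \<i> = \<i> b 1\<close> or \<open>b \<i> = - \<i> b 1\<close>, and in each case one of the two terms of
  \<open>cross e x\<close> cancels.
\<close>

lemma cross_dichotomy:
  assumes e: "e \<noteq> 0"
  shows "\<exists>a. G x = rank1 1 a \<and>
    ((\<forall>v. cross e x v = cinner v (image_vec e) *\<^sub>C a) \<or>
     (\<forall>v. cross e x v = cinner v a *\<^sub>C image_vec e))"
proof (cases "\<exists>c. x = c *\<^sub>C e")
  case True
  then obtain c where x: "x = c *\<^sub>C e" by blast
  have "cross e e v = G e v" for v
  proof -
    have "polar (\<i> *\<^sub>C e) e v = 0"
    proof -
      have "\<i> *\<^sub>C e + e = (\<i> + 1) *\<^sub>C e" "\<i> *\<^sub>C e - e = (\<i> - 1) *\<^sub>C e"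
        by (simp_all add: complex_vector.scale_left_diff_distrib scaleC_add_left scaleC_one)
      then show ?thesis by (simp add: polar_def G_scaleC_apply cmod_power2)
    qed
    moreover have "polar e e v = 4 *\<^sub>R G e v"
      using G_add [of e e v] G_scaleC_apply [of 2 e v] G_scaleC_apply [of 0 e v]
      by (simp add: polar_def scaleC_add_left [of 1 1, simplified] scaleC_one)
    ultimately show ?thesis by (simp add: cross_def)
  qed
  then have "cross e x v = cinner v (image_vec e) *\<^sub>C c *\<^sub>C image_vec e" for v
    by (simp add: x cross_scaleC G_apply scaleC_scaleC mult.commute)
  moreover have "G x = rank1 1 (c *\<^sub>C image_vec e)" by (simp add: x G_scaleC rank1_scaleC)
  ultimately show ?thesis by blast
next
  case par: False
  define E F where "E = image_vec e" and "F = image_vec x"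
  have "\<exists>\<beta>. cmod \<beta> = cmod c \<and>
      (\<forall>v. (1 / 2) *\<^sub>R polar x (c *\<^sub>C e) v = (cnj \<beta> * cinner v E) *\<^sub>C F + (\<beta> * cinner v F) *\<^sub>C E)" for c
  proof -
    obtain \<beta> where \<beta>: "cmod \<beta> = cmod c" "G (x + c *\<^sub>C e) = rank1 1 (F + \<beta> *\<^sub>C E)"
      using image_vec_line [OF par e] unfolding E_def F_def by blast
    have "(1 / 2) *\<^sub>R polar x (c *\<^sub>C e) v = (cnj \<beta> * cinner v E) *\<^sub>C F + (\<beta> * cinner v F) *\<^sub>C E" for v
    proof -
      have "G (c *\<^sub>C e) v = (cmod \<beta>)\<^sup>2 *\<^sub>R cinner v E *\<^sub>C E"
        unfolding G_scaleC_apply \<beta>(1) by (simp add: G_apply E_def)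
      also have "\<dots> = (\<beta> * cnj \<beta> * cinner v E) *\<^sub>C E"
        unfolding mult_cnj_self scaleR_scaleC scaleC_scaleC ..
      finally have Gc: "G (c *\<^sub>C e) v = (\<beta> * cnj \<beta> * cinner v E) *\<^sub>C E" .
      have "(1 / 2) *\<^sub>R polar x (c *\<^sub>C e) v = G (x + c *\<^sub>C e) v - G x v - G (c *\<^sub>C e) v"
        by (simp add: G_add)
      also have "\<dots> = (cnj \<beta> * cinner v E) *\<^sub>C F + (\<beta> * cinner v F) *\<^sub>C E"
        unfolding \<beta>(2) Gc unfolding G_apply F_def [symmetric]
        by (simp add: rank1_def cinner_simps scaleC_add_left scaleC_add_right scaleC_scaleC
            distrib_left mult_ac)
      finally show ?thesis .
    qed
    then show ?thesis using \<beta>(1) by blast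
  qed
  then obtain b where b: "\<And>c. cmod (b c) = cmod c"
    "\<And>c v. (1 / 2) *\<^sub>R polar x (c *\<^sub>C e) v = (cnj (b c) * cinner v E) *\<^sub>C F + (b c * cinner v F) *\<^sub>C E"
    by metis
  have x: "x \<noteq> 0" using par by (rule not_parallel_nonzero)
  have F: "F \<noteq> 0" unfolding F_def by (rule image_vec_nonzero [OF x])
  have "\<nexists>k. E = k *\<^sub>C F"
    using image_vec_parallelD par parallel_sym image_vec_nonzero e x unfolding E_def F_def by metis
  then obtain v where v: "cinner v F = 0" "cinner v E \<noteq> 0"
    using orthogonal_witness by blast
  \<comment> \<open>On \<open>v\<close> only the terms along \<open>F\<close> survive, which makes the additivity of \<open>b\<close> visible.\<close>
  have "polar x ((1 + \<i>) *\<^sub>C e) v = polar x (1 *\<^sub>C e) v + polar x (\<i> *\<^sub>C e) v"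
    by (simp only: scaleC_add_left polar_add_right)
  then have "(cnj (b (1 + \<i>)) * cinner v E) *\<^sub>C F
      = (cnj (b 1) * cinner v E) *\<^sub>C F + (cnj (b \<i>) * cinner v E) *\<^sub>C F"
    using b(2) [of "1 + \<i>" v] b(2) [of 1 v] b(2) [of \<i> v] v(1) by (simp add: scaleR_add_right)
  then have "cnj (b (1 + \<i>)) = cnj (b 1) + cnj (b \<i>)"
    using F v(2) by (simp add: scaleC_add_left [symmetric] distrib_right [symmetric])
  then have sum: "b (1 + \<i>) = b 1 + b \<i>" by (metis complex_cnj_add complex_cnj_cancel_iff)
  have dich: "b \<i> = \<i> * b 1 \<or> b \<i> = - \<i> * b 1"
  proof -
    define g where "g = b \<i> / b 1"
    have b1: "b 1 \<noteq> 0" using b(1) [of 1] by auto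
    have "cmod g = 1" by (simp add: g_def norm_divide b(1))
    moreover have "cmod (1 + g) = cmod (1 + \<i>)"
    proof -
      have "1 + g = b (1 + \<i>) / b 1" using b1 by (simp add: sum g_def add_divide_distrib)
      then show ?thesis by (simp add: norm_divide b(1))
    qed
    then have "(cmod (1 + g))\<^sup>2 = 2" by (simp add: cmod_power2)
    ultimately have "(Re g)\<^sup>2 + (Im g)\<^sup>2 = 1" "(1 + Re g)\<^sup>2 + (Im g)\<^sup>2 = 2"
      using cmod_power2 [of g] cmod_power2 [of "1 + g"] by auto
    moreover from this have "Re g = 0" by (simp add: power2_sum)
    ultimately have "Re g = 0" "(Im g)\<^sup>2 = 1" by simp_all
    then have "g = \<i> \<or> g = - \<i>" by (auto simp: complex_eq_iff power2_eq_1_iff)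
    then show ?thesis using b1 by (auto simp: g_def field_simps)
  qed
  define a where "a = cnj (b 1) *\<^sub>C F"
  have "G x = rank1 1 a" by (simp add: a_def rank1_scaleC b(1) G_def F_def)
  moreover have cross: "cross e x v
      = (1 / 2) *\<^sub>R (((cnj (b 1) + \<i> * cnj (b \<i>)) * cinner v E) *\<^sub>C F
        + ((b 1 + \<i> * b \<i>) * cinner v F) *\<^sub>C E)" for v
  proof -
    have "cross e x v = (1 / 2) *\<^sub>R ((1 / 2) *\<^sub>R polar x (1 *\<^sub>C e) v
        + \<i> *\<^sub>C ((1 / 2) *\<^sub>R polar x (\<i> *\<^sub>C e) v))"
      by (simp add: cross_def polar_ii scaleR_scaleC scaleC_scaleC scaleC_add_right scaleC_one)
    then show ?thesis
      unfolding b(2) by (simp add: scaleC_add_right scaleC_add_left scaleC_scaleC algebra_simps)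
  qed
  from dich have "(\<forall>v. cross e x v = cinner v E *\<^sub>C a) \<or> (\<forall>v. cross e x v = cinner v a *\<^sub>C E)"
  proof
    assume "b \<i> = \<i> * b 1"
    then show ?thesis
      by (simp add: cross a_def scaleR_scaleC scaleC_scaleC)
  next
    assume "b \<i> = - \<i> * b 1"
    then show ?thesis
      by (simp add: cross a_def scaleR_scaleC scaleC_scaleC cinner_scaleC_right)
  qed
  ultimately show ?thesis unfolding E_def by blast
qed

text \<open>
  The vectors for which a given alternative of \<open>cross_dichotomy\<close> holds form a subgroup, and a
  group is not the union of two proper subgroups.
\<close>

lemma implementing_map:
  assumes e: "(e :: 'a) \<noteq> 0"
  shows "\<exists>T. (\<forall>x y. T (x + y) = T x + T y) \<and>
    ((\<forall>c x. T (c *\<^sub>C x) = c *\<^sub>C T x) \<or> (\<forall>c x. T (c *\<^sub>C x) = cnj c *\<^sub>C T x)) \<and>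
    (\<forall>x. \<phi> (rank1 1 x) = rank1 1 (T x))"
proof -
  define E where "E = image_vec e"
  have E: "E \<noteq> 0" unfolding E_def by (rule image_vec_nonzero [OF e])
  define lin where "lin x \<longleftrightarrow> (\<exists>a. \<forall>v. cross e x v = cinner v E *\<^sub>C a)" for x
  define anti where "anti x \<longleftrightarrow> (\<exists>a. \<forall>v. cross e x v = cinner v a *\<^sub>C E)" for x
  have cross_diff: "cross e (x - y) v = cross e x v - cross e y v" for x y v
    using cross_add [of e "x - y" y v] by simp
  have lin_diff: "lin (x - y)" if "lin x" "lin y" for x y
    using that unfolding lin_def cross_diff
    by (metis complex_vector.scale_right_diff_distrib)
  have anti_diff: "anti (x - y)" if "anti x" "anti y" for x y
    using that unfolding anti_def cross_diff
    by (metis complex_vector.scale_left_diff_distrib cinner_diff_right)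
  have either: "lin x \<or> anti x" for x
    using cross_dichotomy [OF e, of x] unfolding lin_def anti_def E_def by blast
  have "(\<forall>x. lin x) \<or> (\<forall>x. anti x)"
  proof (rule ccontr)
    assume "\<not> ?thesis"
    then obtain x y where "\<not> lin x" "\<not> anti y" by blast
    moreover from this have "anti x" "lin y" using either by blast+
    ultimately show False
      using either [of "x + y"] lin_diff [of "x + y" y] anti_diff [of "x + y" x] by auto
  qed
  then show ?thesis
  proof
    assume "\<forall>x. lin x"
    then obtain T where T: "\<And>x v. cross e x v = cinner v E *\<^sub>C T x"
      unfolding lin_def by metis
    have T_eqI: "T x = y" if "cross e x E = cinner E E *\<^sub>C y" for x y
      using that E by (simp add: T)
    have "T (x + y) = T x + T y" for x y
      by (rule T_eqI) (simp add: cross_add T scaleC_add_right)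
    moreover have "T (c *\<^sub>C x) = c *\<^sub>C T x" for c x
      by (rule T_eqI) (simp add: cross_scaleC T scaleC_scaleC mult.commute)
    moreover have "\<phi> (rank1 1 x) = rank1 1 (T x)" for x
    proof -
      obtain a where a: "G x = rank1 1 a" "(\<forall>v. cross e x v = cinner v E *\<^sub>C a) \<or>
          (\<forall>v. cross e x v = cinner v a *\<^sub>C E)"
        using cross_dichotomy [OF e] unfolding E_def by blast
      then have "rank1 1 (T x) = rank1 1 a"
        using T_eqI rank1_eq_if_swapped [OF E] T by metis
      then show ?thesis using a(1) by (simp add: image_vec G_def)
    qed
    ultimately show ?thesis by blast
  next
    assume "\<forall>x. anti x"
    then obtain T where T: "\<And>x v. cross e x v = cinner v (T x) *\<^sub>C E"
      unfolding anti_def by metis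
    have T_eqI: "T x = y" if "\<And>v. cross e x v = cinner v y *\<^sub>C E" for x y
      using that E by (intro cinner_eqI) (simp add: T)
    have "T (x + y) = T x + T y" for x y
      by (rule T_eqI) (simp add: cross_add T scaleC_add_left cinner_add_right)
    moreover have "T (c *\<^sub>C x) = cnj c *\<^sub>C T x" for c x
      by (rule T_eqI) (simp add: cross_scaleC T scaleC_scaleC cinner_scaleC_right)
    moreover have "\<phi> (rank1 1 x) = rank1 1 (T x)" for x
    proof -
      obtain a where a: "G x = rank1 1 a" "(\<forall>v. cross e x v = cinner v E *\<^sub>C a) \<or>
          (\<forall>v. cross e x v = cinner v a *\<^sub>C E)"
        using cross_dichotomy [OF e] unfolding E_def by blast
      then have "rank1 1 (T x) = rank1 1 a"
        using T_eqI rank1_eq_if_swapped [OF E] T by metis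
      then show ?thesis using a(1) by (simp add: image_vec G_def)
    qed
    ultimately show ?thesis by blast
  qed
qed

end

section \<open>The implementing operator is bounded and has an adjoint\<close>

lemma rank1_le_id_iff: "rank1 1 x \<preceq> id \<longleftrightarrow> norm x \<le> 1"
proof
  assume le: "rank1 1 x \<preceq> id"
  show "norm x \<le> 1"
  proof (cases "x = 0")
    case False
    have "((norm x)\<^sup>2)\<^sup>2 \<le> (norm x)\<^sup>2"
      using op_leD [OF le, of x] by (simp add: rank1_inner cinner_self norm_power power2_norm_eq_inner)
    then have "(norm x)\<^sup>2 * (norm x)\<^sup>2 \<le> (norm x)\<^sup>2 * 1"
      by (simp add: power2_eq_square)
    then have "(norm x)\<^sup>2 \<le> 1" by (rule mult_left_le_imp_le) (use False in simp)
    then show ?thesis by (simp add: abs_square_le_1)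
  qed simp
next
  assume le: "norm x \<le> 1"
  show "rank1 1 x \<preceq> id"
  proof (cases "x = 0")
    case False
    show ?thesis
      unfolding op_le_iff [OF rank1_positive_ops [OF zero_le_one] id_positive_ops]
    proof
      fix v
      have "(cmod (cinner v x))\<^sup>2 / (norm x)\<^sup>2 \<le> (norm v)\<^sup>2"
        using positive_ops_Cauchy_Schwarz [OF id_positive_ops, of x v] False
        by (simp add: power2_norm_eq_inner)
      then have "(cmod (cinner v x))\<^sup>2 \<le> (norm v)\<^sup>2 * (norm x)\<^sup>2"
        using False by (simp add: divide_le_eq)
      also have "\<dots> \<le> (norm v)\<^sup>2 * 1"
        using le by (intro mult_left_mono) (simp_all add: power_le_one)
      finally show "inner (rank1 1 x v) v \<le> inner (id v) v"
        by (simp add: rank1_inner power2_norm_eq_inner)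
    qed
  qed (use op_le_plus [OF id_positive_ops, of 0] in simp)
qed

text \<open>
  A functional that attains its norm at \<open>p\<close> is represented by \<open>p\<close>: otherwise moving away from \<open>p\<close>
  would increase it at first order.
\<close>

lemma norm_attaining_functional:
  fixes f :: "'a::real_inner \<Rightarrow> real"
  assumes lin: "linear f" and bound: "\<And>x. (f x)\<^sup>2 \<le> b * (norm x)\<^sup>2"
    and attained: "f p = b" "(norm p)\<^sup>2 \<le> b" and b: "0 < b"
  shows "f x = inner x p"
proof -
  define d where "d = f x - inner x p"
  define K where "K = b * (norm x)\<^sup>2 - (f x)\<^sup>2"
  have K: "0 \<le> K" using bound [of x] by (simp add: K_def)
  have le: "2 * t * b * d \<le> t\<^sup>2 * K" for t
  proof -
    have "(b + t * f x)\<^sup>2 \<le> b * (norm (p + t *\<^sub>R x))\<^sup>2"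
      using bound [of "p + t *\<^sub>R x"] by (simp add: linear_add [OF lin] linear_scale [OF lin] attained)
    also have "(norm (p + t *\<^sub>R x))\<^sup>2 = (norm p)\<^sup>2 + 2 * t * inner x p + t\<^sup>2 * (norm x)\<^sup>2"
      unfolding power2_norm_eq_inner
      by (simp add: inner_add_left inner_add_right inner_commute [of p x] power2_eq_square
          algebra_simps)
    also have "b * \<dots> \<le> b * (b + 2 * t * inner x p + t\<^sup>2 * (norm x)\<^sup>2)"
      using attained b by (intro mult_left_mono) simp_all
    finally show ?thesis by (simp add: d_def K_def algebra_simps power2_eq_square)
  qed
  \<comment> \<open>The denominator \<open>K + 1\<close> replaces the optimal \<open>K\<close>, which may be \<open>0\<close>.\<close>
  define r where "r = b * d / (K + 1)"
  have r: "b * d = r * (K + 1)" using K by (simp add: r_def)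
  have "2 * r * (b * d) \<le> r\<^sup>2 * K" using le [of r] by (simp add: mult.assoc)
  then have "r\<^sup>2 * (K + 2) \<le> 0" by (simp add: r algebra_simps power2_eq_square)
  then have "r = 0" using K by (simp add: mult_le_0_iff)
  then show ?thesis using r b by (simp add: d_def)
qed

text \<open>
  The map \<open>\<kappa>\<close> is the identity or the conjugation, so that linear and conjugate-linear
  operators are treated at once. Adjoints are handled through the real inner product, for which
  their defining equation is the same in both cases.
\<close>

locale implemented_automorphism = order_automorphism \<phi>
  for \<phi> :: "('a::chilbert_space \<Rightarrow> 'a) \<Rightarrow> ('a \<Rightarrow> 'a)" +
  fixes T :: "'a \<Rightarrow> 'a" and \<kappa> :: "complex \<Rightarrow> complex"
  assumes T_add: "T (x + y) = T x + T y"
    and T_scaleC: "T (c *\<^sub>C x) = \<kappa> c *\<^sub>C T x"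
    and \<kappa>: "\<kappa> = (\<lambda>z. z) \<or> \<kappa> = cnj"
    and T_image: "\<phi> (rank1 1 x) = rank1 1 (T x)"
begin

lemma \<kappa>_simps [simp]: "\<kappa> (\<kappa> c) = c" "\<kappa> (of_real r) = of_real r" "cmod (\<kappa> c) = cmod c"
  using \<kappa> by auto

lemma linear_T: "linear T"
  by (rule linearI) (simp_all add: T_add scaleR_scaleC T_scaleC)

lemma T_eq_0: "T x = 0 \<Longrightarrow> x = 0"
  using T_image [of x] zero inj [OF rank1_positive_ops [of 1 x] zero_positive_ops] by simp

lemma inj_T: "inj T"
  by (rule injI) (metis T_eq_0 linear_T linear_diff eq_iff_diff_eq_0)

lemma surj_T: "surj T"
proof -
  have "\<forall>y. \<exists>x. y = T x"
  proof
    fix y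
    interpret inv: order_automorphism \<phi>' by (rule inverse)
    have "\<phi> (\<phi>' (rank1 1 y)) = rank1 1 (T (inv.image_vec y))"
      by (simp add: inv.image_vec T_image)
    then have "rank1 1 y \<preceq> rank1 1 (T (inv.image_vec y))"
      by (simp add: inverse_right rank1_positive_ops op_le_refl)
    then obtain c where "y = c *\<^sub>C T (inv.image_vec y)"
      using rank1_le_imp_parallel zero_less_one by blast
    also have "\<dots> = T (\<kappa> c *\<^sub>C inv.image_vec y)" by (simp add: T_scaleC)
    finally show "\<exists>x. y = T x" by blast
  qed
  then show ?thesis by (simp add: surj_def)
qed

lemma T_inv [simp]: "T (inv T x) = x" "inv T (T x) = x"
  using inj_T surj_T by (simp_all add: surj_f_inv_f)

lemma inverse_implemented: "implemented_automorphism \<phi>' (inv T) \<kappa>"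
proof -
  interpret inv: order_automorphism \<phi>' by (rule inverse)
  have eq: "inv T x = y" if "x = T y" for x y using that by simp
  show ?thesis
  proof
    show "inv T (x + y) = inv T x + inv T y" for x y by (rule eq) (simp add: T_add)
    show "inv T (c *\<^sub>C x) = \<kappa> c *\<^sub>C inv T x" for c x by (rule eq) (simp add: T_scaleC)
    show "\<phi>' (rank1 1 x) = rank1 1 (inv T x)" for x
      using inverse_left [OF rank1_positive_ops [of 1 "inv T x"]] by (simp add: T_image)
  qed (rule \<kappa>)
qed

text \<open>
  The unit ball consists of the \<open>x\<close> with \<open>rank1 1 x \<preceq> id\<close>, so \<open>T\<close> maps it into a set
  that is bounded in terms of the bounded operator \<open>\<phi> id\<close>.
\<close>

lemma norm_le_1_iff_image_le: "norm x \<le> 1 \<longleftrightarrow> rank1 1 (T x) \<preceq> \<phi> id"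
  by (metis T_image id_positive_ops order rank1_le_id_iff rank1_positive_ops zero_le_one)

lemma bounded_linear_T: "bounded_linear T"
proof -
  have "bounded_linear (\<phi> id)"
    using mem [OF id_positive_ops] positive_ops_clinear bounded_clinear_def by blast
  then obtain K where K: "\<And>v. norm (\<phi> id v) \<le> norm v * K" "0 \<le> K"
    using bounded_linear.nonneg_bounded by blast
  have unit: "norm (T x) \<le> sqrt K" if "norm x \<le> 1" for x
  proof (cases "T x = 0")
    case False
    have "((norm (T x))\<^sup>2)\<^sup>2 \<le> inner (\<phi> id (T x)) (T x)"
      using op_leD [OF norm_le_1_iff_image_le [THEN iffD1, OF that], of "T x"]
      by (simp add: rank1_inner cinner_self norm_power)
    also have "\<dots> \<le> norm (\<phi> id (T x)) * norm (T x)" by (rule norm_cauchy_schwarz)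
    also have "\<dots> \<le> (norm (T x) * K) * norm (T x)" by (intro mult_right_mono K) simp
    finally have "(norm (T x))\<^sup>2 * (norm (T x))\<^sup>2 \<le> (norm (T x))\<^sup>2 * K"
      by (simp add: power2_eq_square mult_ac)
    then have "(norm (T x))\<^sup>2 \<le> K"
      by (rule mult_left_le_imp_le) (use False in simp)
    then show ?thesis by (rule real_le_rsqrt)
  qed (use K in simp)
  show ?thesis
  proof (rule bounded_linear_intro)
    show "T (x + y) = T x + T y" for x y by (rule T_add)
    show "T (r *\<^sub>R x) = r *\<^sub>R T x" for r x by (rule linear_scale [OF linear_T])
    show "norm (T x) \<le> norm x * sqrt K" for x
    proof (cases "x = 0")
      case False
      then have "norm (T ((1 / norm x) *\<^sub>R x)) \<le> sqrt K" by (intro unit) simp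
      then show ?thesis using False by (simp add: linear_scale [OF linear_T] field_simps)
    qed (simp add: linear_0 [OF linear_T])
  qed
qed

lemma bounded_linear_inv_T: "bounded_linear (inv T)"
  by (rule implemented_automorphism.bounded_linear_T [OF inverse_implemented])

text \<open>
  If \<open>\<phi> A = T \<circ> A \<circ> T\<^sup>*\<close> for all \<open>A\<close>, then \<open>\<phi> id = T \<circ> T\<^sup>*\<close>; this tells what the
  adjoint has to be.
\<close>

definition adj :: "'a \<Rightarrow> 'a" where
  "adj y = inv T (\<phi> id y)"

text \<open>
  Let \<open>b\<close> be the value of the form of \<open>\<phi> id\<close> at \<open>y\<close>. The functional \<open>x \<mapsto> \<langle>T x, y\<rangle>\<close> has norm at
  most the root of \<open>b\<close>, because \<open>rank1 1 (T x) \<preceq> \<phi> id\<close> on the unit ball. It takes the value \<open>b\<close> at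
  \<open>adj y\<close>, and \<open>adj y\<close> has norm at most the root of \<open>b\<close>, because \<open>T\<close> maps it to
  \<open>\<phi> id y\<close>, which spans a rank-one operator below \<open>\<phi> id\<close>. So the functional attains its norm there.
\<close>

lemma inner_adj: "inner (T x) y = inner x (adj y)"
proof -
  define b where "b = inner (\<phi> id y) y"
  have J: "\<phi> id \<in> positive_ops" using id_positive_ops by (rule mem)
  have b_nonneg: "0 \<le> b" unfolding b_def by (rule positive_ops_form_nonneg [OF J])
  have unit: "(inner (T x) y)\<^sup>2 \<le> b" if "norm x \<le> 1" for x
  proof -
    have "(inner (T x) y)\<^sup>2 \<le> (cmod (cinner y (T x)))\<^sup>2"
      by (simp add: inner_commute inner_eq_Re_cinner abs_Re_le_cmod flip: abs_le_square_iff)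
    also have "\<dots> \<le> b"
      using op_leD [OF norm_le_1_iff_image_le [THEN iffD1, OF that], of y]
      by (simp add: rank1_inner b_def)
    finally show ?thesis .
  qed
  have bound: "(inner (T x) y)\<^sup>2 \<le> b * (norm x)\<^sup>2" for x
  proof (cases "x = 0")
    case False
    then have "(inner (T ((1 / norm x) *\<^sub>R x)) y)\<^sup>2 \<le> b" by (intro unit) simp
    then show ?thesis
      using False by (simp add: linear_scale [OF linear_T] power_divide divide_le_eq)
  qed (simp add: linear_0 [OF linear_T])
  show ?thesis
  proof (cases "b = 0")
    case True
    then have "\<phi> id y = 0" unfolding b_def by (rule positive_ops_kernel [OF J])
    then have "adj y = 0" using T_inv(2) [of 0] by (simp add: adj_def linear_0 [OF linear_T])
    then show ?thesis using bound [of x] True by simp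
  next
    case False
    then have b: "0 < b" using b_nonneg by simp
    have T_adj: "T (adj y) = \<phi> id y" by (simp add: adj_def)
    have "rank1 (1 / b) (\<phi> id y) \<preceq> \<phi> id"
      unfolding b_def by (rule rank1_below_positive_op [OF J]) (use b in \<open>simp add: b_def\<close>)
    then have "rank1 1 (T (sqrt (1 / b) *\<^sub>R adj y)) \<preceq> \<phi> id"
      using b by (simp add: linear_scale [OF linear_T] T_adj rank1_scaleR)
    then have "norm (sqrt (1 / b) *\<^sub>R adj y) \<le> 1" by (simp only: norm_le_1_iff_image_le)
    then have "(norm (sqrt (1 / b) *\<^sub>R adj y))\<^sup>2 \<le> 1" by (simp add: power_le_one)
    then have "(norm (adj y))\<^sup>2 \<le> b"
      using b by (simp add: power_mult_distrib power_divide divide_le_eq)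
    moreover have "linear (\<lambda>x. inner (T x) y)"
      by (rule linearI) (simp_all add: T_add linear_scale [OF linear_T] inner_add_left)
    ultimately show ?thesis
      using norm_attaining_functional [of "\<lambda>x. inner (T x) y" b "adj y" x] bound b
      by (simp add: T_adj b_def)
  qed
qed

lemma adj_scaleC: "adj (c *\<^sub>C y) = \<kappa> c *\<^sub>C adj y"
  using implemented_automorphism.T_scaleC [OF inverse_implemented]
    bounded_clinear_scaleC [OF positive_ops_clinear [OF mem [OF id_positive_ops]]]
  by (simp add: adj_def)

lemma bounded_linear_adj: "bounded_linear adj"
proof -
  have "bounded_linear (\<phi> id)"
    using mem [OF id_positive_ops] positive_ops_clinear bounded_clinear_def by blast
  then show ?thesis
    using bounded_linear_compose [OF bounded_linear_inv_T] by (simp add: adj_def [abs_def])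
qed

lemma cinner_adj: "cinner (T x) y = \<kappa> (cinner x (adj y))"
proof -
  have "cinner (T x) y = Complex (inner x (adj y)) (inner x (\<kappa> \<i> *\<^sub>C adj y))"
    by (simp add: cinner_eq_Complex_inner [of "T x"] inner_adj adj_scaleC)
  then show ?thesis
    using \<kappa> by (auto simp: cinner_eq_Complex_inner [of x] complex_eq_iff)
qed

lemma conjugate_positive_ops:
  assumes A: "A \<in> positive_ops"
  shows "T \<circ> A \<circ> adj \<in> positive_ops"
  unfolding positive_ops_iff bounded_clinear_def
proof (intro conjI allI)
  have "bounded_linear A" using positive_ops_clinear [OF A] by (simp add: bounded_clinear_def)
  then show "bounded_linear (T \<circ> A \<circ> adj)"
    using bounded_linear_compose [OF bounded_linear_T] bounded_linear_compose [of A adj]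
      bounded_linear_adj by (simp add: comp_def)
  show "(T \<circ> A \<circ> adj) (c *\<^sub>C x) = c *\<^sub>C (T \<circ> A \<circ> adj) x" for c x
    by (simp add: adj_scaleC T_scaleC bounded_clinear_scaleC [OF positive_ops_clinear [OF A]])
  show "0 \<le> cinner ((T \<circ> A \<circ> adj) x) x" for x
    using positive_ops_form_nonneg [OF A, of "adj x"]
    by (simp add: cinner_adj positive_ops_form [OF A] less_eq_complex_def)
qed

text \<open>
  A rank-one operator below \<open>\<phi> A\<close> is the image of one below \<open>A\<close>, and conjugation by \<open>T\<close> is monotone.
\<close>

lemma image_le_conjugate:
  assumes A: "A \<in> positive_ops"
  shows "\<phi> A \<preceq> T \<circ> A \<circ> adj"
proof (rule op_le_if_rank1_le [OF mem [OF A] conjugate_positive_ops [OF A]])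
  fix z assume "rank1 1 z \<preceq> \<phi> A"
  then have "\<phi> (rank1 1 (inv T z)) \<preceq> \<phi> A" by (simp add: T_image)
  then have le: "rank1 1 (inv T z) \<preceq> A" using order A rank1_positive_ops by (metis zero_le_one)
  show "rank1 1 z \<preceq> T \<circ> A \<circ> adj"
    unfolding op_le_iff [OF rank1_positive_ops [OF zero_le_one] conjugate_positive_ops [OF A]]
  proof
    fix v
    have "cmod (cinner v z) = cmod (cinner (T (inv T z)) v)"
      using cinner_commute [of v z] by simp
    also have "\<dots> = cmod (cinner (adj v) (inv T z))"
      using cinner_commute [of "adj v"] unfolding cinner_adj by simp
    finally show "inner (rank1 1 z v) v \<le> inner ((T \<circ> A \<circ> adj) v) v"
      using op_leD [OF le, of "adj v"] by (simp add: rank1_inner inner_adj)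
  qed
qed

lemma image_eq_conjugate:
  assumes A: "A \<in> positive_ops"
  shows "\<phi> A = T \<circ> A \<circ> adj"
proof (rule op_le_antisym [OF mem [OF A] conjugate_positive_ops [OF A] image_le_conjugate [OF A]])
  interpret inv: implemented_automorphism \<phi>' "inv T" \<kappa> by (rule inverse_implemented)
  have adj_adj: "inv.adj (adj v) = v" for v
  proof (rule vector_eq_ldot [THEN iffD1], rule allI)
    show "inner x (inv.adj (adj v)) = inner x v" for x
      by (simp flip: inv.inner_adj inner_adj)
  qed
  have le: "A \<preceq> inv T \<circ> \<phi> A \<circ> inv.adj"
    using inv.image_le_conjugate [OF mem [OF A]] by (simp add: inverse_left [OF A])
  show "T \<circ> A \<circ> adj \<preceq> \<phi> A"
    unfolding op_le_iff [OF conjugate_positive_ops [OF A] mem [OF A]]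
  proof
    fix v
    show "inner ((T \<circ> A \<circ> adj) v) v \<le> inner (\<phi> A v) v"
      using op_leD [OF le, of "adj v"] by (simp add: inner_adj inv.inner_adj adj_adj)
  qed
qed

end

theorem theorem1:
  fixes \<phi> :: "('a::chilbert_space \<Rightarrow> 'a) \<Rightarrow> ('a \<Rightarrow> 'a)"
  assumes dim_gt_1: "\<exists>B :: 'a set. finite B \<and> \<not> complex_vector.dependent B \<and> 1 < card B"
    and bij: "bij_betw \<phi> positive_ops positive_ops"
    and order: "\<And>A B. A \<in> positive_ops \<Longrightarrow> B \<in> positive_ops \<Longrightarrow> A \<preceq> B \<longleftrightarrow> \<phi> A \<preceq> \<phi> B"
  shows "\<exists>T :: 'a \<Rightarrow> 'a. invertible_op T \<and>
    (bounded_clinear T \<and> (\<forall>A\<in>positive_ops. \<phi> A = T \<circ> A \<circ> cadjoint T) \<or>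
     bounded_antilinear T \<and> (\<forall>A\<in>positive_ops. \<phi> A = T \<circ> A \<circ> antiadjoint T))"
proof -
  obtain B :: "'a set" where B: "\<not> complex_vector.dependent B" "1 < card B"
    using dim_gt_1 by blast
  then obtain a b where ab: "a \<in> B" "b \<in> B" "a \<noteq> b"
    by (metis card_le_Suc0_iff_eq card.infinite One_nat_def not_less not_one_less_zero)
  have nonzero: "a \<noteq> 0" using B(1) ab complex_vector.dependent_zero by blast
  have not_parallel: "\<exists>y. \<nexists>c. y = c *\<^sub>C x" for x :: 'a
  proof (rule ccontr)
    assume "\<not> ?thesis"
    then obtain c d where c: "a = c *\<^sub>C x" and d: "b = d *\<^sub>C x" by metis
    obtain k where "x = k *\<^sub>C a" using parallel_sym c nonzero by blast
    then have "b = (d * k) *\<^sub>C a" using d by (simp add: scaleC_scaleC)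
    then have "b \<in> complex_vector.span (B - {b})"
      using ab by (metis Diff_iff complex_vector.span_base complex_vector.span_scale singletonD)
    then show False using B(1) ab unfolding complex_vector.dependent_def by blast
  qed
  interpret order_automorphism_dim2 \<phi>
    by unfold_locales (use bij order not_parallel in blast)+
  obtain T where T: "\<And>x y. T (x + y) = T x + T y"
    "(\<forall>c x. T (c *\<^sub>C x) = c *\<^sub>C T x) \<or> (\<forall>c x. T (c *\<^sub>C x) = cnj c *\<^sub>C T x)"
    "\<And>x. \<phi> (rank1 1 x) = rank1 1 (T x)"
    using implementing_map [OF nonzero] by metis
  from T(2) show ?thesis
  proof
    assume lin: "\<forall>c x. T (c *\<^sub>C x) = c *\<^sub>C T x"
    interpret implemented_automorphism \<phi> T "\<lambda>z. z"
      by unfold_locales (simp_all add: T lin)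
    have "cadjoint T = adj"
      by (rule cadjoint_eqI)
        (simp_all add: bounded_clinear_def bounded_linear_adj adj_scaleC cinner_adj)
    then have "\<forall>A\<in>positive_ops. \<phi> A = T \<circ> A \<circ> cadjoint T" by (simp add: image_eq_conjugate)
    then show ?thesis
      using inj_T surj_T bounded_linear_T bounded_linear_inv_T lin
      by (intro exI [of _ T]) (simp add: invertible_op_def bounded_clinear_def bij_def)
  next
    assume lin: "\<forall>c x. T (c *\<^sub>C x) = cnj c *\<^sub>C T x"
    interpret implemented_automorphism \<phi> T cnj
      by unfold_locales (simp_all add: T lin)
    have "antiadjoint T = adj"
    proof (rule antiadjoint_eqI)
      show "cinner (T x) y = cinner (adj y) x" for x y
        unfolding cinner_adj by (metis cinner_commute)
    qed (simp add: bounded_antilinear_def bounded_linear_adj adj_scaleC)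
    then have "\<forall>A\<in>positive_ops. \<phi> A = T \<circ> A \<circ> antiadjoint T" by (simp add: image_eq_conjugate)
    then show ?thesis
      using inj_T surj_T bounded_linear_T bounded_linear_inv_T lin
      by (intro exI [of _ T]) (simp add: invertible_op_def bounded_antilinear_def bij_def)
  qed
qed

end
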